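(* Let $S$ be an update sequence of length $m$ on $[n]$ and let $P\subseteq[n]\times[m]$. Then $P$ is (arboreally) satisfied with respect to $S$ if and only if $P=P(E)$ for some execution $E$ of $S$.
   Context: Update sequences. $S=\langle (s_1,\mathrm{op}_1),\dots,(s_m,\mathrm{op}_m)\rangle$ with $s_t\in[n]$, $\mathrm{op}_t\in\{\mathtt{access},\mathtt{insert},\mathtt{delete}\}$; standing assumptions: for each element its insertions and deletions alternate along $S$, and every $x\in[n]$ occurs in $S$. BST model. A BST is a binary search tree on distinct keys from $[n]$. Given a BST $T_1$, a connected subtree $\tau$ of $T_1$ containing the root, and a BST $\tau'$ whose key set equals that of $\tau$, or that of $\tau$ plus one key not in $T_1$, or that of $\tau$ minus one key, the reconfiguration $\tau\to\tau'$ is valid and transforms $T_1$ into $T_2$ if $T_2$ is a BST on $(\mathrm{keys}(T_1)\setminus\mathrm{keys}(\tau))\cup\mathrm{keys}(\tau')$ in which $\tau'$ is the connected subtree containing the root on the keys of $\tau'$, and every node of $T_1$ not in $\tau$ has the same left and right children in $T_2$ as in $T_1$. Its cost is $\max\{|\tau|,|\tau'|\}$. An execution of $S$ is $E=\langle T_0,\tau_1\to\tau_1',\dots,\tau_m\to\tau_m'\rangle$ where $T_0$ is a BST on a subset of $[n]$, each $\tau_t\to\tau'_t$ is a valid reconfiguration transforming $T_{t-1}$ into $T_t$, and for all $t$: if $\mathrm{op}_t=\mathtt{access}$ then $s_t\in\tau_t$ and $\tau_t'$ has the same key set as $\tau_t$; if $\mathtt{insert}$ then $\mathrm{keys}(\tau'_t)=\mathrm{keys}(\tau_t)\cup\{s_t\}$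 with $s_t\notin\tau_t$; if $\mathtt{delete}$ then $\mathrm{keys}(\tau_t)=\mathrm{keys}(\tau'_t)\cup\{s_t\}$ with $s_t\notin\tau'_t$. Its geometric view is $P(E)=\{(x,t): x\in\tau_t\cup\tau'_t\}$. Geometric view. Points $p=(p_x,p_t)\in[n]\times[m]$. $I=\{(s_t,t):\mathrm{op}_t=\mathtt{insert}\}$, $D=\{(s_t,t):\mathrm{op}_t=\mathtt{delete}\}$, $A=\{(s_t,t):\mathrm{op}_t=\mathtt{access}\}$, $U=I\cup D$, $P(S)=A\cup U$. For a point $p$, let $p'$ (resp. $p''$) be the point of $U$ in column $p_x$ with largest time $<p_t$ (resp. smallest time $>p_t$), if it exists. $p$ is valid iff (1) $p\notin U$, $p'\in I$ or nonexistent, $p''\in D$ or nonexistent; or (2) $p\in I$, $p'\in D$ or nonexistent, $p''\in D$ or nonexistent; or (3) $p\in D$, $p'\in I$ or nonexistent, $p''\in I$ or nonexistent. The active time of a valid $p$ is the maximal interval of consecutive integers containing $p_t$ on which $(p_x,t)$ is valid. $p,q$ with $p_t\le q_t$ form an active pair if $[p_t,q_t]$ lies in the active times of both. $\mathrm{pred}(p)=(x',p_t)$ with $x'$ the largest $x'<p_x$ such that $(x',p_t)$ is valid (if any); $\mathrm{succ}(p)$ symmetric. $\square_{pq}$ is the closed axis-parallel rectangle with opposite corners $p,q$. Satisfied set. $P\subseteq[n]\times[m]$ is satisfied with respect to $S$ if $P\supseteq P(S)$, every point of $P$ is valid, and: (i) for every active pair $p,q\in P$, either $p_x=q_x$ or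 $p_t=q_t$, or there is $r\in(\square_{pq}\cap P)\setminus\{p,q\}$ such that $r\notin D$ if $r_t=\min(p_t,q_t)$ and $r\notin I$ if $r_t=\max(p_t,q_t)$; (ii) for every $p\in U$ such that both $\mathrm{pred}(p)$ and $\mathrm{succ}(p)$ exist, $\mathrm{pred}(p)\in P$ or $\mathrm{succ}(p)\in P$.
   Formalization: Active time is taken within one lifetime: it does not cross a deletion at t followed by reinsertion of the same key at t+1 (literally merged, the claim is false); the empty tree also counts as a connected subtree containing the root, for τ and τ'. *)

theory Defs
  imports Main "HOL-Library.Tree"
begin

section \<open>Update sequences\<close>

datatype operation = Access | Insert | Delete

text \<open>Keys are \<open>{1..n}\<close> and times are \<open>{1..m}\<close> with \<open>m = length S\<close>; the entry
  \<open>(s\<^sub>t, op\<^sub>t)\<close> of the sequence is the list element \<open>S ! (t - 1)\<close>.\<close>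

type_synonym update_seq = "(nat \<times> operation) list"

definition updates_of :: "update_seq \<Rightarrow> nat \<Rightarrow> operation list" where
  "updates_of S x = filter (\<lambda>k. k \<noteq> Access) (map snd (filter (\<lambda>(y, k). y = x) S))"

definition update_sequence :: "nat \<Rightarrow> update_seq \<Rightarrow> bool" where
  "update_sequence n S \<longleftrightarrow>
     fst ` set S = {1..n} \<and> (\<forall>x. successively (\<noteq>) (updates_of S x))"


section \<open>Binary search trees, reconfigurations, executions\<close>

definition bst_on :: "nat \<Rightarrow> nat tree \<Rightarrow> bool" where
  "bst_on n T \<longleftrightarrow> bst T \<and> set_tree T \<subseteq> {1..n}"

text \<open>\<open>top_subtree \<tau> T\<close>: \<open>\<tau>\<close> is a connected part of \<open>T\<close> containing the root, that is,
  \<open>T\<close> with some of its subtrees cut off. The empty part (\<open>\<tau> = Leaf\<close>) is allowed for every \<open>T\<close>.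
  It is needed when a key is inserted above an untouched tree (\<open>\<tau>\<close> empty), for instance
  into the empty tree, and when the only touched key is deleted (\<open>\<tau>'\<close> empty).\<close>

fun top_subtree :: "'a tree \<Rightarrow> 'a tree \<Rightarrow> bool" where
  "top_subtree Leaf T = True"
| "top_subtree (Node l x r) Leaf = False"
| "top_subtree (Node l x r) (Node l' x' r') =
     (x = x' \<and> top_subtree l l' \<and> top_subtree r r')"

fun root_key :: "'a tree \<Rightarrow> 'a option" where
  "root_key Leaf = None"
| "root_key (Node l x r) = Some x"

text \<open>All triples (key of a node, key of its left child, key of its right child), with \<open>None\<close>
  for an absent child.\<close>

definition children :: "'a tree \<Rightarrow> ('a \<times> 'a option \<times> 'a option) set" where
  "children T = {(x, root_key l, root_key r) | l x r. Node l x r \<in> subtrees T}"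

definition reconfiguration :: "nat \<Rightarrow> nat tree \<Rightarrow> nat tree \<Rightarrow> nat tree \<Rightarrow> nat tree \<Rightarrow> bool" where
  "reconfiguration n T1 \<tau> \<tau>' T2 \<longleftrightarrow>
     bst_on n T1 \<and> top_subtree \<tau> T1 \<and> bst_on n \<tau>' \<and>
     (set_tree \<tau>' = set_tree \<tau> \<or>
      (\<exists>k. k \<notin> set_tree T1 \<and> set_tree \<tau>' = insert k (set_tree \<tau>)) \<or>
      (\<exists>k \<in> set_tree \<tau>. set_tree \<tau>' = set_tree \<tau> - {k})) \<and>
     bst_on n T2 \<and> set_tree T2 = (set_tree T1 - set_tree \<tau>) \<union> set_tree \<tau>' \<and>
     top_subtree \<tau>' T2 \<and>
     (\<forall>(x, cl, cr) \<in> children T1. x \<notin> set_tree \<tau> \<longrightarrow> (x, cl, cr) \<in> children T2)"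

definition performs :: "nat \<times> operation \<Rightarrow> nat tree \<times> nat tree \<Rightarrow> bool" where
  "performs sop c = (case (sop, c) of ((s, k), (\<tau>, \<tau>')) \<Rightarrow>
     (case k of
        Access \<Rightarrow> s \<in> set_tree \<tau> \<and> set_tree \<tau>' = set_tree \<tau>
      | Insert \<Rightarrow> s \<notin> set_tree \<tau> \<and> set_tree \<tau>' = insert s (set_tree \<tau>)
      | Delete \<Rightarrow> s \<notin> set_tree \<tau>' \<and> set_tree \<tau> = insert s (set_tree \<tau>')))"

text \<open>The initial tree and the list of pairs \<open>(\<tau>\<^sub>t, \<tau>'\<^sub>t)\<close>, the latter indexed like the
  update sequence.\<close>

type_synonym execution = "nat tree \<times> (nat tree \<times> nat tree) list"

definition execution :: "nat \<Rightarrow> update_seq \<Rightarrow> execution \<Rightarrow> bool" where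
  "execution n S E \<longleftrightarrow>
     bst_on n (fst E) \<and> length (snd E) = length S \<and>
     (\<exists>T :: nat \<Rightarrow> nat tree. T 0 = fst E \<and>
        (\<forall>t \<in> {1..length S}.
           reconfiguration n (T (t - 1)) (fst (snd E ! (t - 1))) (snd (snd E ! (t - 1))) (T t) \<and>
           performs (S ! (t - 1)) (snd E ! (t - 1))))"

definition geometric_view :: "execution \<Rightarrow> (nat \<times> nat) set" where
  "geometric_view E =
     {(x, t). t \<in> {1..length (snd E)} \<and>
        x \<in> set_tree (fst (snd E ! (t - 1))) \<union> set_tree (snd (snd E ! (t - 1)))}"


section \<open>Geometric view\<close>

text \<open>A point is a pair (key, time).\<close>

type_synonym point = "nat \<times> nat"

definition grid :: "nat \<Rightarrow> nat \<Rightarrow> point set" where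
  "grid n m = {1..n} \<times> {1..m}"

definition op_points :: "operation \<Rightarrow> update_seq \<Rightarrow> point set" where
  "op_points k S = {(x, t). t \<in> {1..length S} \<and> S ! (t - 1) = (x, k)}"

abbreviation ins_points :: "update_seq \<Rightarrow> point set" where
  "ins_points \<equiv> op_points Insert"

abbreviation del_points :: "update_seq \<Rightarrow> point set" where
  "del_points \<equiv> op_points Delete"

abbreviation acc_points :: "update_seq \<Rightarrow> point set" where
  "acc_points \<equiv> op_points Access"

definition upd_points :: "update_seq \<Rightarrow> point set" where
  "upd_points S = ins_points S \<union> del_points S"

definition seq_points :: "update_seq \<Rightarrow> point set" where
  "seq_points S = acc_points S \<union> upd_points S"

definition prev_update :: "update_seq \<Rightarrow> point \<Rightarrow> point option" where
  "prev_update S p = (let K = {u. u < snd p \<and> (fst p, u) \<in> upd_points S}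
     in if K = {} then None else Some (fst p, Max K))"

definition next_update :: "update_seq \<Rightarrow> point \<Rightarrow> point option" where
  "next_update S p = (let K = {u. u > snd p \<and> (fst p, u) \<in> upd_points S}
     in if K = {} then None else Some (fst p, Min K))"

text \<open>\<open>set_option q \<subseteq> X\<close> says that \<open>q\<close> is in \<open>X\<close> or nonexistent.\<close>

definition valid :: "nat \<Rightarrow> update_seq \<Rightarrow> point \<Rightarrow> bool" where
  "valid n S p \<longleftrightarrow> p \<in> grid n (length S) \<and>
     (p \<notin> upd_points S \<and>
        set_option (prev_update S p) \<subseteq> ins_points S \<and>
        set_option (next_update S p) \<subseteq> del_points S \<or>
      p \<in> ins_points S \<and>
        set_option (prev_update S p) \<subseteq> del_points S \<and>
        set_option (next_update S p) \<subseteq> del_points S \<or>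
      p \<in> del_points S \<and>
        set_option (prev_update S p) \<subseteq> ins_points S \<and>
        set_option (next_update S p) \<subseteq> ins_points S)"

text \<open>\<open>active_interval n S x a b\<close>: column \<open>x\<close> is valid throughout \<open>{a..b}\<close>, and the interval
  stays within one lifetime of \<open>x\<close>. The last condition matters only when \<open>x\<close> is deleted at some
  time \<open>t\<close> and reinserted at time \<open>t + 1\<close>: then all integer times around \<open>t\<close> are valid, although
  \<open>x\<close> is absent between the two operations. Merging the two lifetimes would make the
  correspondence between satisfied sets and executions fail; for example, on the keys
  \<open>{1..3}\<close>, the sequence delete 1, insert 1, access 2, access 3 has an execution touching
  \<open>{1, 3}\<close>, \<open>{1, 2, 3}\<close>, \<open>{2}\<close>, \<open>{2, 3}\<close>, in which the points \<open>(1, 1)\<close> and \<open>(2, 2)\<close>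
  would form an unsatisfied active pair.\<close>

definition active_interval :: "nat \<Rightarrow> update_seq \<Rightarrow> nat \<Rightarrow> nat \<Rightarrow> nat \<Rightarrow> bool" where
  "active_interval n S x a b \<longleftrightarrow>
     (\<forall>t \<in> {a..b}. valid n S (x, t)) \<and>
     (\<forall>t \<in> {a..<b}. \<not> ((x, t) \<in> del_points S \<and> (x, t + 1) \<in> ins_points S))"

text \<open>The union of all such intervals around the time of \<open>p\<close> is again one, hence the maximal
  one.\<close>

definition active_time :: "nat \<Rightarrow> update_seq \<Rightarrow> point \<Rightarrow> nat set" where
  "active_time n S p =
     \<Union> {{a..b} | a b. snd p \<in> {a..b} \<and> active_interval n S (fst p) a b}"

lemma active_time_no_immediate_reinsertion:
  assumes "\<And>t. (fst p, t) \<in> del_points S \<Longrightarrow> (fst p, t + 1) \<notin> ins_points S"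
  shows "active_time n S p =
     \<Union> {{a..b} | a b. snd p \<in> {a..b} \<and> (\<forall>t \<in> {a..b}. valid n S (fst p, t))}"
proof -
  have "active_interval n S (fst p) a b \<longleftrightarrow> (\<forall>t \<in> {a..b}. valid n S (fst p, t))" for a b
    using assms unfolding active_interval_def by blast
  then show ?thesis
    unfolding active_time_def by simp
qed

lemma active_interval_union:
  assumes "active_interval n S x a b" "active_interval n S x c d"
    and "u \<in> {a..b}" "u \<in> {c..d}"
  shows "active_interval n S x (min a c) (max b d)"
proof -
  have "{min a c..max b d} \<subseteq> {a..b} \<union> {c..d}" "{min a c..<max b d} \<subseteq> {a..<b} \<union> {c..<d}"
    using assms(3,4) by auto
  then show ?thesis
    using assms(1,2) unfolding active_interval_def by blast
qed

definition active_pair :: "nat \<Rightarrow> update_seq \<Rightarrow> point \<Rightarrow> point \<Rightarrow> bool" where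
  "active_pair n S p q \<longleftrightarrow>
     snd p \<le> snd q \<and> {snd p..snd q} \<subseteq> active_time n S p \<inter> active_time n S q"

definition pred_point :: "nat \<Rightarrow> update_seq \<Rightarrow> point \<Rightarrow> point option" where
  "pred_point n S p = (let K = {y. y < fst p \<and> valid n S (y, snd p)}
     in if K = {} then None else Some (Max K, snd p))"

definition succ_point :: "nat \<Rightarrow> update_seq \<Rightarrow> point \<Rightarrow> point option" where
  "succ_point n S p = (let K = {y. y > fst p \<and> valid n S (y, snd p)}
     in if K = {} then None else Some (Min K, snd p))"

definition rect :: "point \<Rightarrow> point \<Rightarrow> point set" where
  "rect p q = {min (fst p) (fst q)..max (fst p) (fst q)} \<times>
              {min (snd p) (snd q)..max (snd p) (snd q)}"

definition satisfied :: "nat \<Rightarrow> update_seq \<Rightarrow> point set \<Rightarrow> bool" where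
  "satisfied n S P \<longleftrightarrow>
     P \<subseteq> grid n (length S) \<and> seq_points S \<subseteq> P \<and> (\<forall>p \<in> P. valid n S p) \<and>
     (\<forall>p \<in> P. \<forall>q \<in> P. active_pair n S p q \<longrightarrow>
        fst p = fst q \<or> snd p = snd q \<or>
        (\<exists>r \<in> (rect p q \<inter> P) - {p, q}.
           (snd r = min (snd p) (snd q) \<longrightarrow> r \<notin> del_points S) \<and>
           (snd r = max (snd p) (snd q) \<longrightarrow> r \<notin> ins_points S))) \<and>
     (\<forall>p \<in> upd_points S. \<forall>a b.
        pred_point n S p = Some a \<and> succ_point n S p = Some b \<longrightarrow> a \<in> P \<or> b \<in> P)"

end

theory Submission
  imports Defs "HOL-Library.Product_Lexorder"
begin

text \<open>The updates alone determine the key set \<open>alive t\<close> of the tree after time \<open>t\<close>, and two points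
  form an active pair iff both keys are alive in between.

  Given an execution, the lowest common ancestor of the two keys of an active pair is touched at
  the first time and at the last time. If neither is a witness, then the first key is an ancestor
  of the second one right after the first time and a descendant of it right before the last time,
  so it is touched in between.

  Given a satisfied set, the tree after time \<open>t\<close> is the treap on \<open>alive t\<close> with the next touch
  as priority. The touched keys form its top. After they are rearranged by their new priorities,
  the heap order could fail only between a touched key and an untouched one with an earlier next
  touch; the closest such pair would be an unsatisfied active pair. The condition on the neighbours
  of updates says that an insertion or a deletion does not split or merge untouched subtrees.\<close>

section \<open>Search trees\<close>

text \<open>Tree \<open>s\<close> stands between times \<open>s\<close> and \<open>s + 1\<close>;
  the operation at time \<open>Suc s\<close> leads from tree \<open>s\<close> to tree
  \<open>Suc s\<close>, and \<open>alive\<close> is indexed alike. With distinct priorities a treap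
  is rigid: the subtree of a key is determined by an interval of keys and their priorities.
  Preservation of children thus becomes a statement about intervals of keys, which is the language
  of rectangles and witnesses.

  One obstacle is that the rectangle of an active pair may meet keys that are not present
  throughout. A key deleted at the first time is absent right after it, and a key inserted at the
  last time is absent right before it; these are the two kinds of witness that condition (i)
  excludes. Keys that appear strictly in between are controlled by condition (ii).

  The other obstacle is that keys never touched again all have the same next touch and no later
  point to form a pair with. Ties are therefore broken so that an offending untouched key has a
  strictly earlier next touch, hence one that is a point of \<open>P\<close>.\<close>

definition ancestor :: "'a tree \<Rightarrow> 'a \<Rightarrow> 'a \<Rightarrow> bool" where
  "ancestor T x y \<longleftrightarrow> (\<exists>l r. Node l x r \<in> subtrees T \<and> y \<in> set_tree (Node l x r))"

lemma subtree_keys: "s \<in> subtrees T \<Longrightarrow> set_tree s \<subseteq> set_tree T"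
  by (induction T) auto

lemma self_subtree [simp]: "T \<in> subtrees T"
  by (cases T) auto

lemma subtrees_trans: "s \<in> subtrees t \<Longrightarrow> t \<in> subtrees T \<Longrightarrow> s \<in> subtrees T"
  by (induction T) auto

lemma key_has_node: "x \<in> set_tree T \<Longrightarrow> \<exists>l r. Node l x r \<in> subtrees T"
  by (induction T) auto

lemma node_key: "Node l x r \<in> subtrees T \<Longrightarrow> x \<in> set_tree T"
  using subtree_keys by fastforce

lemma ancestor_keys: "ancestor T x y \<Longrightarrow> x \<in> set_tree T \<and> y \<in> set_tree T"
  unfolding ancestor_def using subtree_keys by fastforce

text \<open>The search order makes the node of a key a function of the key, so the nodes hidden in
  the existential of \<open>ancestor\<close> can be identified with each other.\<close>

lemma bst_node_unique:
  fixes T :: "'a::linorder tree"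
  assumes "bst T" "Node l x r \<in> subtrees T" "Node l' x r' \<in> subtrees T"
  shows "Node l x r = Node l' x r'"
  using assms
proof (induction T)
  case (Node a c b)
  have a: "x < c" if "Node l x r \<in> subtrees a" for l r
    using Node.prems(1) node_key[OF that] by simp
  have b: "c < x" if "Node l x r \<in> subtrees b" for l r
    using Node.prems(1) node_key[OF that] by simp
  show ?case
  proof (cases x c rule: linorder_cases)
    case less
    then have "Node l x r \<in> subtrees a" "Node l' x r' \<in> subtrees a"
      using Node.prems(2,3) b[of l r] b[of l' r'] by auto
    then show ?thesis using Node.IH(1) Node.prems(1) by simp
  next
    case equal
    then show ?thesis
      using Node.prems(2,3) a[of l r] a[of l' r'] b[of l r] b[of l' r'] by auto
  next
    case greater
    then have "Node l x r \<in> subtrees b" "Node l' x r' \<in> subtrees b"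
      using Node.prems(2,3) a[of l r] a[of l' r'] by auto
    then show ?thesis using Node.IH(2) Node.prems(1) by simp
  qed
qed simp

lemma ancestor_Node:
  "ancestor l x y \<Longrightarrow> ancestor (Node l a r) x y"
  "ancestor r x y \<Longrightarrow> ancestor (Node l a r) x y"
  unfolding ancestor_def by auto

text \<open>Descend from the root while both keys lie strictly on the same side. The key at which
  the descent stops separates them or is one of them, which gives the bounds.\<close>

lemma bst_lca:
  fixes x y :: "'a::linorder"
  assumes "bst T" "x \<in> set_tree T" "y \<in> set_tree T"
  shows "\<exists>z. min x y \<le> z \<and> z \<le> max x y \<and> ancestor T z x \<and> ancestor T z y"
  using assms
proof (induction T)
  case (Node l a r)
  have "x < a \<and> y < a \<or> a < x \<and> a < y \<or> min x y \<le> a \<and> a \<le> max x y"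
    by (cases x a rule: linorder_cases; cases y a rule: linorder_cases)
      (simp_all add: min_le_iff_disj le_max_iff_disj less_imp_le)
  then consider "x < a \<and> y < a" | "a < x \<and> a < y" | "min x y \<le> a \<and> a \<le> max x y" by blast
  then show ?case
  proof cases
    case 1
    then have "x \<in> set_tree l" "y \<in> set_tree l" using Node.prems by auto
    then obtain z where "min x y \<le> z" "z \<le> max x y" "ancestor l z x" "ancestor l z y"
      using Node.IH(1) Node.prems(1) by auto
    then show ?thesis by (intro exI[of _ z]) (simp add: ancestor_Node)
  next
    case 2
    then have "x \<in> set_tree r" "y \<in> set_tree r" using Node.prems by auto
    then obtain z where "min x y \<le> z" "z \<le> max x y" "ancestor r z x" "ancestor r z y"
      using Node.IH(2) Node.prems(1) by auto
    then show ?thesis by (intro exI[of _ z]) (simp add: ancestor_Node)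
  next
    case 3
    have "Node l a r \<in> subtrees (Node l a r)" by simp
    then have "ancestor (Node l a r) a x" "ancestor (Node l a r) a y"
      using Node.prems(2,3) unfolding ancestor_def by blast+
    then show ?thesis using 3 by (intro exI[of _ a]) simp
  qed
qed simp

text \<open>If both ends lie on one side of a key \<open>c\<close>, so does everything between them.
  This will apply to a key that is inserted or deleted between two others.\<close>

lemma bst_ancestor_convex:
  fixes z :: "'a::linorder"
  assumes "bst T" "ancestor T z a" "ancestor T z b" "a \<le> k" "k \<le> b" "k \<in> set_tree T"
  shows "ancestor T z k"
proof -
  have convex: "k \<in> set_tree s"
    if "s \<in> subtrees T" "a \<in> set_tree s" "b \<in> set_tree s" for s
    using assms(1,4-6) that
  proof (induction T)
    case (Node l c r)
    consider "s = Node l c r" | "s \<in> subtrees l" | "s \<in> subtrees r" using Node.prems by auto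
    then show ?case
    proof cases
      case 2
      then have "b < c" using subtree_keys[OF 2] Node.prems by auto
      then show ?thesis using Node 2 by auto
    next
      case 3
      then have "c < a" using subtree_keys[OF 3] Node.prems by auto
      then show ?thesis using Node 3 by auto
    qed (use Node in auto)
  qed simp
  show ?thesis
    using assms(2,3) bst_node_unique[OF assms(1)] convex unfolding ancestor_def by blast
qed

lemma bst_subtree: "bst T \<Longrightarrow> s \<in> subtrees T \<Longrightarrow> bst s"
  by (induction T) auto

text \<open>If the keys differ, the node of \<open>y\<close> lies inside a child of the node of
  \<open>x\<close>; then \<open>x\<close> would occur in its own child.\<close>

lemma bst_ancestor_antisym:
  assumes "bst T" "ancestor T x y" "ancestor T y x"
  shows "x = y"
proof (rule ccontr)
  assume neq: "x \<noteq> y"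
  obtain l r l' r' where x: "Node l x r \<in> subtrees T" "y \<in> set_tree (Node l x r)"
    and y: "Node l' y r' \<in> subtrees T" "x \<in> set_tree (Node l' y r')"
    using assms(2,3) unfolding ancestor_def by blast
  obtain s where s: "s = l \<or> s = r" "y \<in> set_tree s" using x(2) neq by auto
  then obtain l'' r'' where y': "Node l'' y r'' \<in> subtrees s" using key_has_node by metis
  moreover have "s \<in> subtrees T" using s(1) subtrees_trans[OF _ x(1), of s] by auto
  ultimately have "Node l'' y r'' = Node l' y r'"
    using y(1) bst_node_unique[OF assms(1)] subtrees_trans by blast
  then have "x \<in> set_tree s" using subtree_keys[OF y'] y(2) by auto
  then show False using s(1) bst_subtree[OF assms(1) x(1)] by auto
qed

section \<open>Connected tops and what a reconfiguration preserves\<close>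

lemma top_subtree_keys: "top_subtree \<tau> T \<Longrightarrow> set_tree \<tau> \<subseteq> set_tree T"
  by (induction \<tau> T rule: top_subtree.induct) auto

text \<open>The search path of \<open>x\<close> turns the same way in \<open>T\<close> and in
  \<open>\<tau>\<close>, so all nodes on it belong to \<open>\<tau>\<close>. This is how touching a
  key forces its ancestors to be touched.\<close>

lemma top_subtree_ancestor:
  assumes "top_subtree \<tau> T" "bst T" "ancestor T z x" "x \<in> set_tree \<tau>"
  shows "z \<in> set_tree \<tau>"
proof -
  have "z \<in> set_tree \<tau>" if "Node l z r \<in> subtrees T" "x \<in> set_tree (Node l z r)" for l r
    using assms(1,2,4) that
  proof (induction \<tau> T rule: top_subtree.induct)
    case (3 l1 a r1 l2 b r2)
    have top: "a = b" "set_tree l1 \<subseteq> set_tree l2" "set_tree r1 \<subseteq> set_tree r2"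
      using 3(3) top_subtree_keys by auto
    consider "z = b" | "Node l z r \<in> subtrees l2" | "Node l z r \<in> subtrees r2"
      using 3(6) by auto
    then show ?case
    proof cases
      case l: 2
      then have "x \<in> set_tree l2" using subtree_keys[OF l] 3(7) by blast
      then have "x < b" "x \<notin> set_tree r1" using 3(4) top(3) by (auto dest: less_asym)
      then have "x \<in> set_tree l1" using 3(5) top(1) by auto
      then show ?thesis using 3(1) 3(3,4,7) l by simp
    next
      case r: 3
      then have "x \<in> set_tree r2" using subtree_keys[OF r] 3(7) by blast
      then have "b < x" "x \<notin> set_tree l1" using 3(4) top(2) by (auto dest: less_asym)
      then have "x \<in> set_tree r1" using 3(5) top(1) by auto
      then show ?thesis using 3(2) 3(3,4,7) r by simp
    qed (simp add: top)
  qed auto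
  then show ?thesis using assms(3) unfolding ancestor_def by blast
qed

text \<open>The definition fixes only the keys of the children of an untouched node. Everything
  below such a node is untouched too, because tops are closed under ancestors, so induction recovers
  the whole subtree from these local data.\<close>

lemma reconfiguration_keeps_subtrees:
  assumes rc: "reconfiguration n T1 \<tau> \<tau>' T2"
    and "Node l x r \<in> subtrees T1" "x \<notin> set_tree \<tau>"
  shows "Node l x r \<in> subtrees T2"
proof -
  have b: "bst T1" "bst T2" and top: "top_subtree \<tau> T1"
    and ch: "\<And>x cl cr. (x, cl, cr) \<in> children T1 \<Longrightarrow> x \<notin> set_tree \<tau> \<Longrightarrow> (x, cl, cr) \<in> children T2"
    using rc unfolding reconfiguration_def bst_on_def by auto
  have child: "c = c'"
    if root: "root_key c = root_key c'" and sub: "c' \<in> subtrees T2"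
      and keep: "\<And>l y r. c = Node l y r \<Longrightarrow> Node l y r \<in> subtrees T2" for c c'
  proof (cases c)
    case Leaf
    then show ?thesis using root by (cases c') auto
  next
    case (Node l y r)
    then obtain l' r' where "c' = Node l' y r'" using root Node by (cases c') auto
    then show ?thesis using sub keep[OF Node] bst_node_unique[OF b(2)] Node by metis
  qed
  have "s \<in> subtrees T2"
    if "s \<in> subtrees T1" "set_tree s \<inter> set_tree \<tau> = {}" "s \<noteq> Leaf" for s
    using that
  proof (induction s)
    case (Node l x r)
    have sub: "l \<in> subtrees T1" "r \<in> subtrees T1"
      by (rule subtrees_trans[OF _ Node.prems(1)], simp)+
    have "(x, root_key l, root_key r) \<in> children T1"
      using Node.prems(1) unfolding children_def by blast
    then have "(x, root_key l, root_key r) \<in> children T2" using ch Node.prems(2) by simp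
    then obtain l' r' where n': "Node l' x r' \<in> subtrees T2"
      and rk: "root_key l = root_key l'" "root_key r = root_key r'"
      unfolding children_def by blast
    have sub': "l' \<in> subtrees T2" "r' \<in> subtrees T2"
      by (rule subtrees_trans[OF _ n'], simp)+
    have "l = l'" using Node.IH(1) sub(1) Node.prems(2) by (intro child rk sub') auto
    moreover have "r = r'" using Node.IH(2) sub(2) Node.prems(2) by (intro child rk sub') auto
    ultimately show ?case using n' by simp
  qed simp
  moreover have "set_tree (Node l x r) \<inter> set_tree \<tau> = {}"
    using top_subtree_ancestor[OF top b(1)] assms(2,3) unfolding ancestor_def by blast
  ultimately show ?thesis using assms(2) by blast
qed

lemma reconfiguration_keeps_ancestor:
  assumes rc: "reconfiguration n T1 \<tau> \<tau>' T2" and "x \<notin> set_tree \<tau>"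
  shows "ancestor T1 x y \<Longrightarrow> ancestor T2 x y"
  using reconfiguration_keeps_subtrees[OF rc] assms(2) unfolding ancestor_def by blast

text \<open>A key of \<open>T2\<close> outside \<open>\<tau>'\<close> was already in
  \<open>T1\<close> outside \<open>\<tau>\<close>, so its subtree was carried over
  unchanged.\<close>

lemma reconfiguration_keeps_ancestor_rev:
  assumes rc: "reconfiguration n T1 \<tau> \<tau>' T2" and "x \<notin> set_tree \<tau>'" and "ancestor T2 x y"
  shows "ancestor T1 x y"
proof -
  have b: "bst T2" and "set_tree T2 = (set_tree T1 - set_tree \<tau>) \<union> set_tree \<tau>'"
    using rc unfolding reconfiguration_def bst_on_def by auto
  then have x: "x \<in> set_tree T1" "x \<notin> set_tree \<tau>"
    using assms(2) ancestor_keys[OF assms(3)] by auto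
  obtain l r where lr: "Node l x r \<in> subtrees T1" using key_has_node[OF x(1)] by blast
  then have "Node l x r \<in> subtrees T2" using reconfiguration_keeps_subtrees[OF rc] x(2) by blast
  then show ?thesis
    using assms(3) lr bst_node_unique[OF b] unfolding ancestor_def by blast
qed


section \<open>Treaps\<close>

text \<open>The Cartesian tree of \<open>f\<close> on \<open>A\<close>. \<open>arg_min_on\<close>
  makes a choice among ties, so uniqueness has to come from injectivity of \<open>f\<close>;
  finiteness provides the minimum and the decreasing cardinality.\<close>

function treap :: "('a::linorder \<Rightarrow> 'b::linorder) \<Rightarrow> 'a set \<Rightarrow> 'a tree" where
  "treap f A = (if finite A \<and> A \<noteq> {}
     then Node (treap f {x \<in> A. x < arg_min_on f A}) (arg_min_on f A)
               (treap f {x \<in> A. arg_min_on f A < x})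
     else Leaf)"
  by auto
termination
proof (relation "measure (\<lambda>(f, A). card A)")
  fix f :: "'a \<Rightarrow> 'b" and A :: "'a set"
  assume A: "finite A \<and> A \<noteq> {}"
  then have "arg_min_on f A \<in> A" by (simp add: arg_min_if_finite)
  then show "((f, {x \<in> A. x < arg_min_on f A}), (f, A)) \<in> measure (\<lambda>(f, A). card A)"
    and "((f, {x \<in> A. arg_min_on f A < x}), (f, A)) \<in> measure (\<lambda>(f, A). card A)"
    using A by (auto intro!: psubset_card_mono)
qed simp

declare treap.simps [simp del]

lemma treap_empty [simp]: "treap f {} = Leaf"
  by (simp add: treap.simps)

lemma arg_min_on_le: "finite A \<Longrightarrow> x \<in> A \<Longrightarrow> (f (arg_min_on f A) :: 'b::linorder) \<le> f x"
  by (metis arg_min_if_finite(2) empty_iff leI)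

lemma treap_induct [consumes 1, case_names empty node]:
  fixes f :: "'a::linorder \<Rightarrow> 'b::linorder"
  assumes "finite A" and "P {}"
    and step: "\<And>A r. \<lbrakk>finite A; r \<in> A; \<And>x. x \<in> A \<Longrightarrow> f r \<le> f x; r = arg_min_on f A;
      treap f A = Node (treap f {x \<in> A. x < r}) r (treap f {x \<in> A. r < x});
      P {x \<in> A. x < r}; P {x \<in> A. r < x}\<rbrakk> \<Longrightarrow> P A"
  shows "P A"
  using assms(1)
proof (induction "card A" arbitrary: A rule: less_induct)
  case less
  show ?case
  proof (cases "A = {}")
    case False
    let ?r = "arg_min_on f A"
    have r: "?r \<in> A" using False less.prems by (simp add: arg_min_if_finite)
    show ?thesis
    proof (rule step[OF less.prems r _ refl])
      show "f ?r \<le> f x" if "x \<in> A" for x using arg_min_on_le[OF less.prems that] .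
      show "treap f A = Node (treap f {x \<in> A. x < ?r}) ?r (treap f {x \<in> A. ?r < x})"
        using False less.prems by (subst treap.simps) simp
      show "P {x \<in> A. x < ?r}" "P {x \<in> A. ?r < x}"
        using r less.prems by (auto intro!: less.hyps psubset_card_mono)
    qed
  qed (use assms(2) in simp)
qed

lemma set_treap [simp]: "finite A \<Longrightarrow> set_tree (treap f A) = A"
  by (induction rule: treap_induct[where f = f]) auto

lemma bst_treap: "finite A \<Longrightarrow> bst (treap f A)"
  by (induction rule: treap_induct[where f = f]) auto

lemma treap_cong: "finite A \<Longrightarrow> (\<And>x. x \<in> A \<Longrightarrow> f x = g x) \<Longrightarrow> treap f A = treap g A"
proof (induction rule: treap_induct[where f = f])
  case (node A r)
  have "arg_min_on g A = arg_min_on f A"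
    unfolding arg_min_on_def arg_min_def is_arg_min_def
    using node.prems by (intro arg_cong[where f = Eps]) auto
  then have r: "arg_min_on g A = r" using node.hyps by simp
  have "treap g A = Node (treap g {x \<in> A. x < r}) r (treap g {x \<in> A. r < x})"
    using node.hyps(1,2) r by (subst treap.simps) auto
  then show ?case using node.IH node.prems node.hyps by simp
qed simp

text \<open>The keys of the subtree rooted at \<open>x\<close> in a treap on \<open>A\<close> with priorities \<open>f\<close>.\<close>

definition cone :: "('a::linorder \<Rightarrow> 'b::linorder) \<Rightarrow> 'a set \<Rightarrow> 'a \<Rightarrow> 'a set" where
  "cone f A x = {y \<in> A. \<forall>z \<in> A. min x y \<le> z \<and> z \<le> max x y \<longrightarrow> f x \<le> f z}"

text \<open>Serves the descent into a recursive call: \<open>B\<close> is the part of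
  \<open>A\<close> on one side of the root and contains every key of \<open>A\<close> between its
  members and \<open>x\<close>, so the quantifier in \<open>cone\<close> meets the same
  keys.\<close>

lemma cone_restrict:
  assumes "B \<subseteq> A" "cone f A x \<subseteq> B"
    and "\<And>y z. y \<in> B \<Longrightarrow> z \<in> A \<Longrightarrow> min x y \<le> z \<Longrightarrow> z \<le> max x y \<Longrightarrow> z \<in> B"
  shows "cone f A x = cone f B x"
proof (intro set_eqI iffI)
  fix y assume "y \<in> cone f A x"
  then show "y \<in> cone f B x" using assms(1,2) unfolding cone_def by auto
next
  fix y assume y: "y \<in> cone f B x"
  then have "y \<in> B" unfolding cone_def by simp
  have "f x \<le> f z" if "z \<in> A" "min x y \<le> z \<and> z \<le> max x y" for z
  proof -
    have "z \<in> B" using assms(3)[OF \<open>y \<in> B\<close> that(1)] that(2) by simp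
    then show ?thesis using y that(2) unfolding cone_def by simp
  qed
  then show "y \<in> cone f A x" using \<open>y \<in> B\<close> assms(1) unfolding cone_def by auto
qed

text \<open>The cone of the root is the whole set. Any other \<open>x\<close> has a strictly larger
  priority than the root \<open>c\<close> by injectivity, so its cone cannot reach across
  \<open>c\<close> and stays in the part where the recursion finds \<open>x\<close>.\<close>

lemma treap_subtree:
  assumes "finite A" "inj_on f A" "Node l x r \<in> subtrees (treap f A)"
  shows "Node l x r = treap f (cone f A x)"
  using assms
proof (induction rule: treap_induct[where f = f])
  case (node A c)
  consider "Node l x r = treap f A" "x = c"
    | "Node l x r \<in> subtrees (treap f {y \<in> A. y < c})"
    | "Node l x r \<in> subtrees (treap f {y \<in> A. c < y})"
    using node.prems(2) node.hyps(5) by auto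
  then show ?case
  proof cases
    case 1
    then have "cone f A x = A" using node.hyps(3) unfolding cone_def by auto
    then show ?thesis using 1 by simp
  next
    case 2
    then have x: "x \<in> A" "x < c" using node_key[OF 2] node.hyps(1) by auto
    then have "\<not> f x \<le> f c" using node.hyps(2,3) node.prems(1) by (metis antisym inj_onD less_irrefl)
    moreover have "f x \<le> f c" if "y \<in> cone f A x" "\<not> y < c" for y
    proof -
      have "min x y \<le> c" "c \<le> max x y" using x that(2) by auto
      then show ?thesis using that(1) node.hyps(2) unfolding cone_def by blast
    qed
    ultimately have "cone f A x \<subseteq> {y \<in> A. y < c}" unfolding cone_def by blast
    then have "cone f A x = cone f {y \<in> A. y < c} x"
      using x by (intro cone_restrict) (auto simp: le_max_iff_disj)
    moreover have "inj_on f {y \<in> A. y < c}" using node.prems(1) by (rule inj_on_subset) auto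
    ultimately show ?thesis using node.IH(1) 2 by simp
  next
    case 3
    then have x: "x \<in> A" "c < x" using node_key[OF 3] node.hyps(1) by auto
    then have "\<not> f x \<le> f c" using node.hyps(2,3) node.prems(1) by (metis antisym inj_onD less_irrefl)
    moreover have "f x \<le> f c" if "y \<in> cone f A x" "\<not> c < y" for y
    proof -
      have "min x y \<le> c" "c \<le> max x y" using x that(2) by auto
      then show ?thesis using that(1) node.hyps(2) unfolding cone_def by blast
    qed
    ultimately have "cone f A x \<subseteq> {y \<in> A. c < y}" unfolding cone_def by blast
    then have "cone f A x = cone f {y \<in> A. c < y} x"
      using x by (intro cone_restrict) (auto simp: min_le_iff_disj)
    moreover have "inj_on f {y \<in> A. c < y}" using node.prems(1) by (rule inj_on_subset) auto
    ultimately show ?thesis using node.IH(2) 3 by simp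
  qed
qed simp

text \<open>Both subtrees at \<open>x\<close> are treaps on one set with the same priorities, hence
  equal. The clause on children in a reconfiguration is thereby reduced to a comparison of
  cones.\<close>

lemma treap_children_eq:
  assumes "finite A" "inj_on f A" "finite B" "inj_on g B" "x \<in> B"
    and "cone f A x = cone g B x" "\<And>y. y \<in> cone f A x \<Longrightarrow> f y = g y"
    and "(x, cl, cr) \<in> children (treap f A)"
  shows "(x, cl, cr) \<in> children (treap g B)"
proof -
  obtain l r where lr: "cl = root_key l" "cr = root_key r" "Node l x r \<in> subtrees (treap f A)"
    using assms(8) unfolding children_def by auto
  obtain l' r' where lr': "Node l' x r' \<in> subtrees (treap g B)"
    using key_has_node[of x "treap g B"] assms(3,5) by auto
  have "finite (cone f A x)" using assms(1) unfolding cone_def by simp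
  then have "Node l x r = Node l' x r'"
    unfolding treap_subtree[OF assms(1,2) lr(3)] treap_subtree[OF assms(3,4) lr'] assms(6)[symmetric]
    using assms(7) by (rule treap_cong)
  then show ?thesis using lr lr' unfolding children_def by blast
qed

text \<open>The last hypothesis says that \<open>B\<close> contains all treap ancestors of its
  members. A nonempty \<open>B\<close> then contains the root of \<open>A\<close>, which is also the
  minimum of \<open>B\<close>, and the two sides follow recursively.\<close>

lemma treap_top_subtree:
  assumes "finite A" "inj_on f A" "B \<subseteq> A"
    and "\<And>b x. b \<in> B \<Longrightarrow> x \<in> A \<Longrightarrow> b \<in> cone f A x \<Longrightarrow> x \<in> B"
  shows "top_subtree (treap f B) (treap f A)"
  using assms
proof (induction arbitrary: B rule: treap_induct[where f = f])
  case (node A r)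
  show ?case
  proof (cases "B = {}")
    case False
    have fB: "finite B" using node.hyps(1) node.prems(2) finite_subset by blast
    have "cone f A r = A" using node.hyps(3) unfolding cone_def by auto
    then have rB: "r \<in> B" using False node.prems(2,3) node.hyps(2) by blast
    let ?s = "arg_min_on f B"
    have s: "?s \<in> B" "f ?s \<le> f r"
      using fB False arg_min_on_le[OF fB rB, of f] by (auto simp: arg_min_if_finite)
    then have "?s = r"
      using node.hyps(2,3) node.prems(1,2) by (metis antisym inj_onD subsetD)
    then have B: "treap f B = Node (treap f {x \<in> B. x < r}) r (treap f {x \<in> B. r < x})"
      using fB False by (subst treap.simps) simp
    have "top_subtree (treap f {x \<in> B. x < r}) (treap f {x \<in> A. x < r})"
    proof (rule node.IH(1))
      show "inj_on f {x \<in> A. x < r}" using node.prems(1) by (rule inj_on_subset) auto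
      fix b x assume *: "b \<in> {x \<in> B. x < r}" "x \<in> {x \<in> A. x < r}" "b \<in> cone f {x \<in> A. x < r} x"
      have "z < r" if "z \<le> max x b" for z
        using that * node.prems(2) by (auto simp: cone_def le_max_iff_disj min_le_iff_disj)
      then have "b \<in> cone f A x" using * node.prems(2) unfolding cone_def by blast
      then show "x \<in> {x \<in> B. x < r}" using * node.prems(3) by blast
    qed (use node.prems(2) in auto)
    moreover have "top_subtree (treap f {x \<in> B. r < x}) (treap f {x \<in> A. r < x})"
    proof (rule node.IH(2))
      show "inj_on f {x \<in> A. r < x}" using node.prems(1) by (rule inj_on_subset) auto
      fix b x assume *: "b \<in> {x \<in> B. r < x}" "x \<in> {x \<in> A. r < x}" "b \<in> cone f {x \<in> A. r < x} x"
      have "r < z" if "min x b \<le> z" for z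
        using that * node.prems(2) by (auto simp: cone_def le_max_iff_disj min_le_iff_disj)
      then have "b \<in> cone f A x" using * node.prems(2) unfolding cone_def by blast
      then show "x \<in> {x \<in> B. r < x}" using * node.prems(3) by blast
    qed (use node.prems(2) in auto)
    ultimately show ?thesis using node.hyps(5) B by simp
  qed simp
qed auto

section \<open>Lifetimes of keys\<close>

lemma op_points_unique:
  "(x, t) \<in> op_points k S \<Longrightarrow> (y, t) \<in> op_points k' S \<Longrightarrow> x = y \<and> k = k'"
  unfolding op_points_def by auto

lemma op_points_time: "(x, t) \<in> op_points k S \<Longrightarrow> 1 \<le> t \<and> t \<le> length S"
  unfolding op_points_def by auto

lemma upd_points_iff:
  "(x, t) \<in> upd_points S \<longleftrightarrow> (\<exists>k. k \<noteq> Access \<and> (x, t) \<in> op_points k S)"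
  unfolding upd_points_def using operation.exhaust by (auto; metis)

lemma upd_points_unique: "(x, t) \<in> upd_points S \<Longrightarrow> (y, t) \<in> upd_points S \<Longrightarrow> x = y"
  unfolding upd_points_iff using op_points_unique by blast

lemma ins_del_disjoint: "(x, t) \<in> ins_points S \<Longrightarrow> (x, t) \<notin> del_points S"
  using op_points_unique by blast

lemma updates_of_append: "updates_of (S @ S') x = updates_of S x @ updates_of S' x"
  unfolding updates_of_def by simp

lemma updates_of_take_last:
  assumes "(x, t) \<in> op_points k S" "k \<noteq> Access"
  shows "updates_of (take t S) x = updates_of (take (t - 1) S) x @ [k]"
proof -
  have "take t S = take (t - 1) S @ [(x, k)]"
    using assms(1) take_Suc_conv_app_nth[of "t - 1" S] unfolding op_points_def by auto
  then show ?thesis using assms(2) by (simp add: updates_of_append) (simp add: updates_of_def)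
qed

text \<open>Filtering leaves no update of \<open>x\<close> between times \<open>u\<close> and
  \<open>v\<close>, so the one at time \<open>v\<close> heads the list.\<close>

lemma updates_of_drop_hd:
  assumes "(x, v) \<in> op_points k S" "k \<noteq> Access" "u < v"
    and none: "\<And>w. u < w \<Longrightarrow> w < v \<Longrightarrow> (x, w) \<notin> upd_points S"
  shows "\<exists>ks. updates_of (drop u S) x = k # ks"
proof -
  have v: "1 \<le> v" "v \<le> length S" "S ! (v - 1) = (x, k)"
    using assms(1) unfolding op_points_def by auto
  have "drop u S = take (v - 1 - u) (drop u S) @ drop (v - 1) S"
    using assms(3) by (metis add.commute append_take_drop_id drop_drop le_add_diff_inverse2
        Suc_diff_1 less_Suc_eq_le v(1) less_eq_Suc_le One_nat_def)
  moreover have "drop (v - 1) S = (x, k) # drop v S"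
    using v Cons_nth_drop_Suc[of "v - 1" S] by simp
  moreover have "updates_of (take (v - 1 - u) (drop u S)) x = []"
  proof -
    have "k' = Access" if mem: "(x, k') \<in> set (take (v - 1 - u) (drop u S))" for k'
    proof (rule ccontr)
      assume k': "k' \<noteq> Access"
      obtain i where i: "i < v - 1 - u" "S ! (u + i) = (x, k')"
        using mem v by (auto simp: in_set_conv_nth)
      then have "(x, u + i + 1) \<in> op_points k' S" using v unfolding op_points_def by auto
      moreover have "u + i + 1 < v" using i(1) by linarith
      ultimately show False using none[of "u + i + 1"] k' unfolding upd_points_iff by auto
    qed
    then show ?thesis unfolding updates_of_def by (auto simp: filter_empty_conv)
  qed
  ultimately have "updates_of (drop u S) x = updates_of ((x, k) # drop v S) x"
    by (metis append_Nil updates_of_append)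
  then show ?thesis using assms(2) unfolding updates_of_def by simp
qed

text \<open>Trades \<open>Max\<close> for quantifiers: every earlier update is in \<open>X\<close>
  or superseded before \<open>t\<close>. In this form validity can be compared with
  \<open>alive\<close>.\<close>

lemma prev_update_subset:
  "set_option (prev_update S (x, t)) \<subseteq> X \<longleftrightarrow>
    (\<forall>u<t. (x, u) \<in> upd_points S \<longrightarrow> (x, u) \<in> X \<or> (\<exists>w. u < w \<and> w < t \<and> (x, w) \<in> upd_points S))"
proof -
  define K where "K = {u. u < t \<and> (x, u) \<in> upd_points S}"
  have fin: "finite K" unfolding K_def by simp
  have prev: "prev_update S (x, t) = (if K = {} then None else Some (x, Max K))"
    unfolding prev_update_def K_def Let_def by simp
  have "(K \<noteq> {} \<longrightarrow> (x, Max K) \<in> X) \<longleftrightarrow> (\<forall>u\<in>K. (x, u) \<in> X \<or> (\<exists>w\<in>K. u < w))"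
    using fin Max_in[OF fin] Max_ge[OF fin] by (metis empty_iff leD le_less)
  then show ?thesis unfolding prev K_def by auto
qed

lemma next_update_subset:
  "set_option (next_update S (x, t)) \<subseteq> X \<longleftrightarrow>
    (\<forall>u>t. (x, u) \<in> upd_points S \<longrightarrow> (x, u) \<in> X \<or> (\<exists>w. t < w \<and> w < u \<and> (x, w) \<in> upd_points S))"
proof -
  define K where "K = {u. u > t \<and> (x, u) \<in> upd_points S}"
  have "K \<subseteq> {..length S}" unfolding K_def upd_points_iff using op_points_time by auto
  then have fin: "finite K" using finite_subset by blast
  have "next": "next_update S (x, t) = (if K = {} then None else Some (x, Min K))"
    unfolding next_update_def K_def Let_def by simp
  have "(K \<noteq> {} \<longrightarrow> (x, Min K) \<in> X) \<longleftrightarrow> (\<forall>u\<in>K. (x, u) \<in> X \<or> (\<exists>w\<in>K. w < u))"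
    using fin Min_in[OF fin] Min_le[OF fin] by (metis empty_iff leD le_less)
  then show ?thesis unfolding "next" K_def by auto
qed

lemma pred_point_Some:
  assumes "valid n S (y, t)" "y < x"
  obtains a where "pred_point n S (x, t) = Some (a, t)" "y \<le> a" "a < x" "valid n S (a, t)"
proof -
  define K where "K = {y. y < x \<and> valid n S (y, t)}"
  have K: "finite K" "y \<in> K" unfolding K_def using assms by auto
  then have "pred_point n S (x, t) = Some (Max K, t)"
    unfolding pred_point_def K_def Let_def by auto
  moreover have "Max K \<in> K" "y \<le> Max K" using K Max_in by auto
  ultimately show ?thesis using that unfolding K_def by blast
qed

lemma succ_point_Some:
  assumes "valid n S (y, t)" "x < y"
  obtains a where "succ_point n S (x, t) = Some (a, t)" "a \<le> y" "x < a" "valid n S (a, t)"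
proof -
  define K where "K = {y. y > x \<and> valid n S (y, t)}"
  have "K \<subseteq> {1..n}" unfolding K_def valid_def grid_def by auto
  then have K: "finite K" "y \<in> K" unfolding K_def using assms finite_subset by auto
  then have "succ_point n S (x, t) = Some (Min K, t)"
    unfolding succ_point_def K_def Let_def by auto
  moreover have "Min K \<in> K" "Min K \<le> y" using K Min_in by auto
  ultimately show ?thesis using that unfolding K_def by blast
qed

lemma pred_pointD:
  assumes "pred_point n S (x, t) = Some p"
  obtains a where "p = (a, t)" "a < x" "valid n S (a, t)"
    "\<And>z. valid n S (z, t) \<Longrightarrow> z < x \<Longrightarrow> z \<le> a"
proof -
  define K where "K = {y. y < x \<and> valid n S (y, t)}"
  have "p = (Max K, t)" "K \<noteq> {}"
    using assms unfolding pred_point_def K_def Let_def by (auto split: if_splits)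
  moreover have "finite K" unfolding K_def by simp
  ultimately show ?thesis using that[of "Max K"] Max_in[of K] Max_ge[of K] unfolding K_def by auto
qed

lemma succ_pointD:
  assumes "succ_point n S (x, t) = Some p"
  obtains a where "p = (a, t)" "x < a" "valid n S (a, t)"
    "\<And>z. valid n S (z, t) \<Longrightarrow> x < z \<Longrightarrow> a \<le> z"
proof -
  define K where "K = {y. y > x \<and> valid n S (y, t)}"
  have "p = (Min K, t)" "K \<noteq> {}"
    using assms unfolding succ_point_def K_def Let_def by (auto split: if_splits)
  moreover have "K \<subseteq> {1..n}" unfolding K_def valid_def grid_def by auto
  then have "finite K" using finite_subset by blast
  ultimately show ?thesis using that[of "Min K"] Min_in[of K] Min_le[of K] unfolding K_def by auto
qed

section \<open>Presence of keys, validity and active pairs\<close>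

locale updates =
  fixes n :: nat and S :: update_seq
  assumes seq: "update_sequence n S"
begin

lemma op_points_key:
  assumes "(x, t) \<in> op_points k S"
  shows "x \<in> {1..n}"
proof -
  have "(x, k) \<in> set S" using assms nth_mem[of "t - 1" S] unfolding op_points_def by auto
  then have "x \<in> fst ` set S" by (metis fst_conv imageI)
  then show ?thesis using seq unfolding update_sequence_def by simp
qed

text \<open>Cut the sequence after time \<open>u\<close>: the updates of \<open>x\<close> in the
  first part end with \<open>k\<close>, those in the second part begin with
  \<open>k'\<close>.\<close>

lemma updates_alternate:
  assumes "(x, u) \<in> op_points k S" "(x, v) \<in> op_points k' S" "k \<noteq> Access" "k' \<noteq> Access" "u < v"
    and none: "\<And>w. u < w \<Longrightarrow> w < v \<Longrightarrow> (x, w) \<notin> upd_points S"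
  shows "k \<noteq> k'"
proof -
  have "successively (\<noteq>) (updates_of (take u S @ drop u S) x)"
    using seq unfolding update_sequence_def by simp
  then show ?thesis
    using updates_of_take_last[OF assms(1,3)] updates_of_drop_hd[OF assms(2,4,5) none]
    unfolding updates_of_append by (auto simp: successively_append_iff)
qed

text \<open>The keys present right after time \<open>t\<close> in any execution, read off from the updates alone.\<close>

definition alive :: "nat \<Rightarrow> nat set" where
  "alive t = {x \<in> {1..n}.
     (\<forall>u\<le>t. (x, u) \<in> del_points S \<longrightarrow> (\<exists>w. u < w \<and> w \<le> t \<and> (x, w) \<in> upd_points S)) \<and>
     (\<forall>v>t. (x, v) \<in> ins_points S \<longrightarrow> (\<exists>w. t < w \<and> w < v \<and> (x, w) \<in> upd_points S))}"

lemma alive_key: "x \<in> alive t \<Longrightarrow> x \<in> {1..n}"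
  unfolding alive_def by blast

lemma finite_alive [simp]: "finite (alive t)"
  unfolding alive_def by simp

lemma alive_Suc_other:
  assumes "(x, Suc t) \<notin> upd_points S"
  shows "x \<in> alive (Suc t) \<longleftrightarrow> x \<in> alive t"
proof -
  have "u \<le> Suc t \<and> (x, u) \<in> upd_points S \<longleftrightarrow> u \<le> t \<and> (x, u) \<in> upd_points S" for u
    using assms by (cases "u = Suc t") auto
  moreover have "Suc t < u \<and> (x, u) \<in> upd_points S \<longleftrightarrow> t < u \<and> (x, u) \<in> upd_points S" for u
    using assms by (cases "u = Suc t") auto
  moreover have "del_points S \<subseteq> upd_points S" "ins_points S \<subseteq> upd_points S"
    unfolding upd_points_def by auto
  ultimately show ?thesis unfolding alive_def by blast
qed

lemma alive_insert:
  assumes ins: "(x, Suc t) \<in> ins_points S"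
  shows "x \<in> alive (Suc t)" "x \<notin> alive t"
proof -
  have upd: "(x, Suc t) \<in> upd_points S" using ins unfolding upd_points_def by blast
  have "\<exists>w. u < w \<and> w \<le> Suc t \<and> (x, w) \<in> upd_points S"
    if "u \<le> Suc t" "(x, u) \<in> del_points S" for u
  proof -
    have "u \<noteq> Suc t" using ins that(2) ins_del_disjoint by blast
    then show ?thesis using upd that(1) by (intro exI[of _ "Suc t"]) auto
  qed
  moreover have "\<exists>w. Suc t < w \<and> w < v \<and> (x, w) \<in> upd_points S"
    if "Suc t < v" "(x, v) \<in> ins_points S" for v
    using updates_alternate[OF ins that(2) _ _ that(1)] by blast
  ultimately show "x \<in> alive (Suc t)"
    using op_points_key[OF ins] unfolding alive_def by blast
  show "x \<notin> alive t" using ins unfolding alive_def by fastforce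
qed

lemma alive_delete:
  assumes del: "(x, Suc t) \<in> del_points S"
  shows "x \<in> alive t" "x \<notin> alive (Suc t)"
proof -
  have upd: "(x, Suc t) \<in> upd_points S" using del unfolding upd_points_def by blast
  have "\<exists>w. u < w \<and> w \<le> t \<and> (x, w) \<in> upd_points S" if "u \<le> t" "(x, u) \<in> del_points S" for u
    using updates_alternate[OF that(2) del] that(1) by (auto simp: less_Suc_eq_le)
  moreover have "\<exists>w. t < w \<and> w < v \<and> (x, w) \<in> upd_points S"
    if "t < v" "(x, v) \<in> ins_points S" for v
  proof -
    have "v \<noteq> Suc t" using del that(2) ins_del_disjoint by blast
    then show ?thesis using upd that(1) by (intro exI[of _ "Suc t"]) auto
  qed
  ultimately show "x \<in> alive t" using op_points_key[OF del] unfolding alive_def by blast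
  show "x \<notin> alive (Suc t)" using del unfolding alive_def by fastforce
qed

lemma alive_Suc_iff:
  "x \<in> alive (Suc t) \<longleftrightarrow>
    (x \<in> alive t \<or> (x, Suc t) \<in> ins_points S) \<and> (x, Suc t) \<notin> del_points S"
  using alive_Suc_other alive_insert alive_delete unfolding upd_points_def by blast

text \<open>At an update of \<open>x\<close>, alternation makes both neighbouring updates of the
  right kind, and \<open>x\<close> is present on exactly one side. Elsewhere the conditions on the
  neighbours are those that define \<open>alive\<close>.\<close>

lemma valid_Suc_iff:
  "valid n S (x, Suc t) \<longleftrightarrow> t < length S \<and> (x \<in> alive t \<or> x \<in> alive (Suc t))"
proof -
  let ?p = "(x, Suc t)"
  have alt: "(x, u) \<in> (if k = Insert then del_points S else ins_points S) \<or>
      (\<exists>w. u < w \<and> w < Suc t \<and> (x, w) \<in> upd_points S)"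
    if lt: "u < Suc t" and u: "(x, u) \<in> upd_points S" and t: "?p \<in> op_points k S" "k \<noteq> Access" for u k
  proof (cases "\<exists>w. u < w \<and> w < Suc t \<and> (x, w) \<in> upd_points S")
    case False
    obtain k' where k': "k' \<noteq> Access" "(x, u) \<in> op_points k' S"
      using u unfolding upd_points_iff by blast
    then have "k' \<noteq> k" using updates_alternate[OF k'(2) t(1) k'(1) t(2) lt] False by blast
    then show ?thesis using k' t(2) unfolding upd_points_def by (cases k; cases k') auto
  qed simp
  have alt': "(x, u) \<in> (if k = Insert then del_points S else ins_points S) \<or>
      (\<exists>w. Suc t < w \<and> w < u \<and> (x, w) \<in> upd_points S)"
    if lt: "Suc t < u" and u: "(x, u) \<in> upd_points S" and t: "?p \<in> op_points k S" "k \<noteq> Access" for u k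
  proof (cases "\<exists>w. Suc t < w \<and> w < u \<and> (x, w) \<in> upd_points S")
    case False
    obtain k' where k': "k' \<noteq> Access" "(x, u) \<in> op_points k' S"
      using u unfolding upd_points_iff by blast
    then have "k \<noteq> k'" using updates_alternate[OF t(1) k'(2) t(2) k'(1) lt] False by blast
    then show ?thesis using k' t(2) unfolding upd_points_def by (cases k; cases k') auto
  qed simp
  have grid: "?p \<in> grid n (length S) \<longleftrightarrow> x \<in> {1..n} \<and> t < length S" unfolding grid_def by auto
  consider "?p \<in> ins_points S" | "?p \<in> del_points S" | "?p \<notin> upd_points S"
    unfolding upd_points_def by blast
  then show ?thesis
  proof cases
    case 1
    have "valid n S ?p"
      unfolding valid_def prev_update_subset next_update_subset grid
      using 1 alt[OF _ _ 1] alt'[OF _ _ 1] op_points_key[OF 1] op_points_time[OF 1] by auto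
    then show ?thesis using alive_insert[OF 1] op_points_time[OF 1] by auto
  next
    case 2
    have "valid n S ?p"
      unfolding valid_def prev_update_subset next_update_subset grid
      using 2 alt[OF _ _ 2] alt'[OF _ _ 2] op_points_key[OF 2] op_points_time[OF 2] by auto
    then show ?thesis using alive_delete[OF 2] op_points_time[OF 2] by auto
  next
    case 3
    have "x \<in> alive (Suc t) \<longleftrightarrow> x \<in> {1..n} \<and>
      (\<forall>u<Suc t. (x, u) \<in> upd_points S \<longrightarrow>
        (x, u) \<in> ins_points S \<or> (\<exists>w. u < w \<and> w < Suc t \<and> (x, w) \<in> upd_points S)) \<and>
      (\<forall>u>Suc t. (x, u) \<in> upd_points S \<longrightarrow>
        (x, u) \<in> del_points S \<or> (\<exists>w. Suc t < w \<and> w < u \<and> (x, w) \<in> upd_points S))"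
    proof -
      have del: "(x, u) \<in> del_points S \<longleftrightarrow> (x, u) \<in> upd_points S \<and> (x, u) \<notin> ins_points S" for u
        unfolding upd_points_def using ins_del_disjoint by auto
      have ins: "(x, u) \<in> ins_points S \<longleftrightarrow> (x, u) \<in> upd_points S \<and> (x, u) \<notin> del_points S" for u
        unfolding upd_points_def using ins_del_disjoint by auto
      have le: "(x, u) \<in> upd_points S \<Longrightarrow> u \<le> Suc t \<longleftrightarrow> u < Suc t" for u
        using 3 by (cases "u = Suc t") auto
      have "(\<forall>u\<le>Suc t. (x, u) \<in> del_points S \<longrightarrow>
          (\<exists>w. u < w \<and> w \<le> Suc t \<and> (x, w) \<in> upd_points S)) \<longleftrightarrow>
        (\<forall>u<Suc t. (x, u) \<in> upd_points S \<longrightarrow>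
          (x, u) \<in> ins_points S \<or> (\<exists>w. u < w \<and> w < Suc t \<and> (x, w) \<in> upd_points S))"
        unfolding del using le by (metis (no_types))
      moreover have "(\<forall>u>Suc t. (x, u) \<in> ins_points S \<longrightarrow>
          (\<exists>w. Suc t < w \<and> w < u \<and> (x, w) \<in> upd_points S)) \<longleftrightarrow>
        (\<forall>u>Suc t. (x, u) \<in> upd_points S \<longrightarrow>
          (x, u) \<in> del_points S \<or> (\<exists>w. Suc t < w \<and> w < u \<and> (x, w) \<in> upd_points S))"
        unfolding ins by (metis (no_types))
      ultimately show ?thesis unfolding alive_def by simp
    qed
    then have "valid n S ?p \<longleftrightarrow> t < length S \<and> x \<in> alive (Suc t)"
      using 3 unfolding valid_def prev_update_subset next_update_subset grid
      by (auto simp: upd_points_def)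
    then show ?thesis using alive_Suc_other[OF 3] by blast
  qed
qed

text \<open>A key valid at all these times but absent from tree \<open>s\<close> is deleted at time
  \<open>s\<close> and inserted at time \<open>s + 1\<close>, the junction of lifetimes that
  \<open>active_interval\<close> forbids. Trees \<open>t\<close> and \<open>Suc u\<close> are left
  out because \<open>x\<close> may be inserted at \<open>Suc t\<close> or deleted at
  \<open>Suc u\<close>.\<close>

lemma active_interval_iff:
  assumes "t < u"
  shows "active_interval n S x (Suc t) (Suc u) \<longleftrightarrow>
    u < length S \<and> (\<forall>s\<in>{t<..u}. x \<in> alive s)"
proof
  assume a: "active_interval n S x (Suc t) (Suc u)"
  have v: "valid n S (x, Suc s)" if "t \<le> s" "s \<le> u" for s
    using a that unfolding active_interval_def by simp
  have "x \<in> alive s" if s: "s \<in> {t<..u}" for s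
  proof (rule ccontr)
    assume na: "x \<notin> alive s"
    obtain r where r: "s = Suc r" using s by (cases s) auto
    have "x \<in> alive r" "x \<in> alive (Suc s)"
      using v[of r] v[of s] s na r unfolding valid_Suc_iff by auto
    then have "(x, s) \<in> del_points S" "(x, s + 1) \<in> ins_points S"
      using na r alive_Suc_iff[of x r] alive_Suc_iff[of x s] by auto
    then show False using a s unfolding active_interval_def by force
  qed
  then show "u < length S \<and> (\<forall>s\<in>{t<..u}. x \<in> alive s)"
    using v[of u] assms unfolding valid_Suc_iff by simp
next
  assume r: "u < length S \<and> (\<forall>s\<in>{t<..u}. x \<in> alive s)"
  have "valid n S (x, s)" if s: "s \<in> {Suc t..Suc u}" for s
  proof -
    obtain s' where s': "s = Suc s'" using s by (cases s) auto
    then have "x \<in> alive s' \<or> x \<in> alive (Suc s')" using r s assms by (cases "s' = t") auto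
    then show ?thesis using s r unfolding s' valid_Suc_iff by auto
  qed
  moreover have "(x, s) \<notin> del_points S" if s: "s \<in> {Suc t..<Suc u}" for s
  proof -
    obtain s' where s': "s = Suc s'" using s by (cases s) auto
    then show ?thesis using r s alive_delete(2)[of x s'] by auto
  qed
  ultimately show "active_interval n S x (Suc t) (Suc u)" unfolding active_interval_def by blast
qed

lemma active_pair_iff:
  assumes "t < u"
  shows "active_pair n S (x, Suc t) (y, Suc u) \<longleftrightarrow>
    u < length S \<and> (\<forall>s\<in>{t<..u}. x \<in> alive s \<and> y \<in> alive s)"
proof -
  \<comment> \<open>Inclusion in the union \<open>active_time\<close> yields possibly different
    intervals around the two ends; they share \<open>v\<close>, so their union is again
    active.\<close>
  have *: "{a..b} \<subseteq> active_time n S (z, v) \<longleftrightarrow> active_interval n S z a b"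
    if "v \<in> {a..b}" for z v a b
  proof
    assume "{a..b} \<subseteq> active_time n S (z, v)"
    then have "a \<in> active_time n S (z, v)" "b \<in> active_time n S (z, v)" using that by auto
    then obtain c d c' d' where cd: "v \<in> {c..d}" "active_interval n S z c d" "a \<in> {c..d}"
      "v \<in> {c'..d'}" "active_interval n S z c' d'" "b \<in> {c'..d'}"
      unfolding active_time_def by auto
    then have "active_interval n S z (min c c') (max d d')"
      using active_interval_union by blast
    then show "active_interval n S z a b" using cd unfolding active_interval_def by auto
  next
    assume "active_interval n S z a b"
    then show "{a..b} \<subseteq> active_time n S (z, v)" using that unfolding active_time_def by auto
  qed
  show ?thesis
    unfolding active_pair_def using assms *[of "Suc t" "Suc t" "Suc u"] *[of "Suc u" "Suc t" "Suc u"]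
      active_interval_iff[OF assms] by auto
qed

end

section \<open>From executions to satisfied sets\<close>

text \<open>The parts \<open>a s\<close> and \<open>b s\<close> belong to the operation at time
  \<open>Suc s\<close>, which is entry \<open>s\<close> of the list \<open>S\<close>.\<close>

locale run = updates +
  fixes T a b :: "nat \<Rightarrow> nat tree"
  assumes reconf: "s < length S \<Longrightarrow> reconfiguration n (T s) (a s) (b s) (T (Suc s))"
    and perf: "s < length S \<Longrightarrow> performs (S ! s) (a s, b s)"
    and keys_0: "set_tree (T 0) \<subseteq> {1..n}"
begin

definition touched :: "nat \<Rightarrow> nat set" where
  "touched s = set_tree (a s) \<union> set_tree (b s)"

lemma
  assumes "s < length S"
  shows bst_before: "bst (T s)" and bst_after: "bst (T (Suc s))"
    and top_before: "top_subtree (a s) (T s)" and top_after: "top_subtree (b s) (T (Suc s))"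
    and keys_Suc: "set_tree (T (Suc s)) = (set_tree (T s) - set_tree (a s)) \<union> set_tree (b s)"
    and keys_Suc_subset: "set_tree (T (Suc s)) \<subseteq> {1..n}"
  using reconf[OF assms] unfolding reconfiguration_def bst_on_def by auto

lemma
  assumes "s < length S"
  shows a_keys: "set_tree (a s) \<subseteq> set_tree (T s)"
    and b_keys: "set_tree (b s) \<subseteq> set_tree (T (Suc s))"
  using top_subtree_keys top_before[OF assms] top_after[OF assms] by auto

text \<open>A key in \<open>b s\<close> but not in \<open>a s\<close> has been inserted, and an
  inserted key is new to the whole tree.\<close>

lemma touched_before:
  assumes "s < length S" "x \<in> touched s" "x \<in> set_tree (T s)"
  shows "x \<in> set_tree (a s)"
  using reconf[OF assms(1)] assms(2,3) unfolding reconfiguration_def touched_def by auto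

lemma touched_after:
  assumes "s < length S" "x \<in> touched s" "x \<in> set_tree (T (Suc s))"
  shows "x \<in> set_tree (b s)"
  using keys_Suc[OF assms(1)] assms(2,3) unfolding touched_def by auto

lemma op_points_Suc_iff: "(x, Suc s) \<in> op_points k S \<longleftrightarrow> s < length S \<and> S ! s = (x, k)"
  unfolding op_points_def by auto

lemma run_insert:
  assumes "(x, Suc s) \<in> ins_points S"
  shows "x \<notin> set_tree (T s)" "set_tree (T (Suc s)) = insert x (set_tree (T s))" "x \<in> touched s"
proof -
  have s: "s < length S" "S ! s = (x, Insert)" using assms op_points_Suc_iff by auto
  then have b: "x \<notin> set_tree (a s)" "set_tree (b s) = insert x (set_tree (a s))"
    using perf[OF s(1)] unfolding performs_def by auto
  then show "x \<in> touched s" unfolding touched_def by simp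
  show "x \<notin> set_tree (T s)"
    using touched_before[OF s(1)] b(1) \<open>x \<in> touched s\<close> by blast
  show "set_tree (T (Suc s)) = insert x (set_tree (T s))"
    unfolding keys_Suc[OF s(1)] b(2) using a_keys[OF s(1)] by auto
qed

lemma run_delete:
  assumes "(x, Suc s) \<in> del_points S"
  shows "x \<in> set_tree (T s)" "set_tree (T (Suc s)) = set_tree (T s) - {x}" "x \<in> touched s"
proof -
  have s: "s < length S" "S ! s = (x, Delete)" using assms op_points_Suc_iff by auto
  then have a: "x \<notin> set_tree (b s)" "set_tree (a s) = insert x (set_tree (b s))"
    using perf[OF s(1)] unfolding performs_def by auto
  then show "x \<in> touched s" unfolding touched_def by simp
  have sub: "insert x (set_tree (b s)) \<subseteq> set_tree (T s)" using a_keys[OF s(1)] a(2) by simp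
  then show "x \<in> set_tree (T s)" by simp
  show "set_tree (T (Suc s)) = set_tree (T s) - {x}"
    unfolding keys_Suc[OF s(1)] a(2) using a(1) sub by auto
qed

lemma run_access:
  assumes "(x, Suc s) \<in> acc_points S"
  shows "x \<in> set_tree (T s)" "set_tree (T (Suc s)) = set_tree (T s)" "x \<in> touched s"
proof -
  have s: "s < length S" "S ! s = (x, Access)" using assms op_points_Suc_iff by auto
  then have a: "x \<in> set_tree (a s)" "set_tree (b s) = set_tree (a s)"
    using perf[OF s(1)] unfolding performs_def by auto
  then show "x \<in> touched s" unfolding touched_def by simp
  have sub: "set_tree (a s) \<subseteq> set_tree (T s)" using a_keys[OF s(1)] .
  then show "x \<in> set_tree (T s)" using a(1) by blast
  show "set_tree (T (Suc s)) = set_tree (T s)"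
    unfolding keys_Suc[OF s(1)] a(2) using sub by auto
qed

text \<open>Each operation changes the presence of \<open>x\<close> in the tree and in
  \<open>alive\<close> alike, so agreement at one time spreads to all times. An update of
  \<open>x\<close> provides such a time; a key without updates is accessed, since it occurs in
  \<open>S\<close>. In particular the initial key set is forced.\<close>

lemma keys_alive:
  assumes "s \<le> length S"
  shows "set_tree (T s) = alive s"
proof -
  have "x \<in> set_tree (T s) \<longleftrightarrow> x \<in> alive s" if x: "x \<in> {1..n}" for x
  proof -
    let ?agree = "\<lambda>s. x \<in> set_tree (T s) \<longleftrightarrow> x \<in> alive s"
    have step: "?agree (Suc s) \<longleftrightarrow> ?agree s" if s: "s < length S" for s
    proof -
      obtain y k where yk: "(y, Suc s) \<in> op_points k S"
        using s op_points_Suc_iff by (metis surj_pair)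
      show ?thesis
      proof (cases "x = y \<and> k \<noteq> Access")
        case True
        then show ?thesis
          using yk run_insert[of x s] run_delete[of x s] alive_insert[of x s] alive_delete[of x s]
          by (cases k) auto
      next
        case False
        then have "(x, Suc s) \<notin> upd_points S"
          using op_points_unique[OF yk] unfolding upd_points_iff by metis
        moreover have "x \<in> set_tree (T (Suc s)) \<longleftrightarrow> x \<in> set_tree (T s)"
          using False yk run_insert(2)[of y s] run_delete(2)[of y s] run_access(2)[of y s]
          by (cases k) auto
        ultimately show ?thesis using alive_Suc_other by simp
      qed
    qed
    have all: "s \<le> length S \<Longrightarrow> ?agree s \<longleftrightarrow> ?agree 0" for s
    proof (induction s)
      case (Suc s)
      then show ?case using step[of s] by simp
    qed simp
    have "\<exists>s\<le>length S. ?agree s"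
    proof (cases "\<exists>t. (x, t) \<in> upd_points S")
      case True
      then obtain t k where t: "(x, t) \<in> op_points k S" "k \<noteq> Access"
        unfolding upd_points_iff by blast
      then obtain s where s: "t = Suc s" "t \<le> length S"
        using op_points_time[OF t(1)] by (cases t) auto
      have "?agree t"
        using t s(1) run_insert[of x s] run_delete[of x s] alive_insert[of x s] alive_delete[of x s]
        by (cases k) auto
      then show ?thesis using s(2) by blast
    next
      case False
      then have "x \<in> alive s" for s using x unfolding alive_def upd_points_def by auto
      moreover have "x \<in> fst ` set S" using seq x unfolding update_sequence_def by simp
      then obtain s k where s: "s < length S" "S ! s = (x, k)"
        by (auto simp: in_set_conv_nth)
      then have "(x, Suc s) \<in> op_points k S" using op_points_Suc_iff by blast
      moreover have "k = Access" using False calculation(2) unfolding upd_points_iff by blast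
      ultimately show ?thesis using run_access(1) s(1) less_imp_le by blast
    qed
    then show ?thesis using all assms by blast
  qed
  moreover have "set_tree (T s) \<subseteq> {1..n}"
    using assms keys_0 keys_Suc_subset[of "s - 1"] by (cases s) auto
  ultimately show ?thesis using alive_key by blast
qed

lemma untouched_keeps_ancestor:
  assumes "s < length S" "x \<notin> touched s" "ancestor (T s) x y"
  shows "ancestor (T (Suc s)) x y"
  using reconfiguration_keeps_ancestor[OF reconf[OF assms(1)]] assms(2,3)
  unfolding touched_def by blast

lemma active_pair_witness:
  assumes "t < u" "u < length S" and alive: "\<And>s. s \<in> {t<..u} \<Longrightarrow> x \<in> alive s \<and> y \<in> alive s"
    and "x \<in> touched t" "y \<in> touched u" "x \<noteq> y"
  shows "\<exists>z s. min x y \<le> z \<and> z \<le> max x y \<and> t \<le> s \<and> s \<le> u \<and> z \<in> touched s \<and>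
    (z, s) \<noteq> (x, t) \<and> (z, s) \<noteq> (y, u) \<and>
    (s = t \<longrightarrow> (z, Suc s) \<notin> del_points S) \<and> (s = u \<longrightarrow> (z, Suc s) \<notin> ins_points S)"
proof (rule ccontr)
  assume "\<not> ?thesis"
  then have none: "(z, s) = (x, t) \<or> (z, s) = (y, u)"
    if "min x y \<le> z" "z \<le> max x y" "t \<le> s" "s \<le> u" "z \<in> touched s"
      "s = t \<longrightarrow> (z, Suc s) \<notin> del_points S" "s = u \<longrightarrow> (z, Suc s) \<notin> ins_points S" for z s
    using that by blast
  have t: "t < length S" using assms(1,2) by simp
  have keys: "set_tree (T (Suc t)) = alive (Suc t)" "set_tree (T u) = alive u"
    using keys_alive assms(1,2) by auto
  have "x \<in> set_tree (T (Suc t))" "y \<in> set_tree (T (Suc t))"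
    using alive[of "Suc t"] assms(1) keys(1) by auto
  then obtain z where z: "min x y \<le> z" "z \<le> max x y"
    "ancestor (T (Suc t)) z x" "ancestor (T (Suc t)) z y"
    using bst_lca[OF bst_after[OF t]] by meson
  have "x \<in> set_tree (b t)" using touched_after[OF t assms(4)] alive[of "Suc t"] assms(1) keys(1) by auto
  then have zb: "z \<in> set_tree (b t)"
    using top_subtree_ancestor[OF top_after[OF t] bst_after[OF t] z(3)] by blast
  \<comment> \<open>The common ancestor is present after the operation, so it is not the deleted key
    and would be an admissible witness; only \<open>z = x\<close> escapes.\<close>
  then have "(z, Suc t) \<notin> del_points S"
    using alive_delete(2) b_keys[OF t] keys(1) by blast
  then have "z = x"
    using none[OF z(1,2), of t] zb assms(1) unfolding touched_def by auto
  then have anc: "ancestor (T (Suc t)) x y" using z(4) by simp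
  have untouched: "x \<notin> touched s" if "t < s" "s < u" for s
    using none[of x s] that by auto
  have "Suc t \<le> s \<Longrightarrow> s \<le> u \<Longrightarrow> ancestor (T s) x y" for s
  proof (induction s rule: dec_induct)
    case (step s)
    then show ?case using untouched_keeps_ancestor[of s x y] untouched[of s] assms(2) by simp
  qed (rule anc)
  then have anc': "ancestor (T u) x y" using assms(1) by simp
  have yu: "x \<in> set_tree (T u)" "y \<in> set_tree (T u)" using alive[of u] assms(1) keys(2) by auto
  then obtain w where w: "min x y \<le> w" "w \<le> max x y" "ancestor (T u) w x" "ancestor (T u) w y"
    using bst_lca[OF bst_before[OF assms(2)]] by meson
  have "y \<in> set_tree (a u)" using touched_before[OF assms(2,5) yu(2)] .
  then have wa: "w \<in> set_tree (a u)"
    using top_subtree_ancestor[OF top_before[OF assms(2)] bst_before[OF assms(2)] w(4)] by blast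
  then have "(w, Suc u) \<notin> ins_points S"
    using alive_insert(2) a_keys[OF assms(2)] keys(2) by blast
  then have "w = y"
    using none[OF w(1,2), of u] wa assms(1) unfolding touched_def by auto
  then show False
    using bst_ancestor_antisym[OF bst_before[OF assms(2)] anc'] w(3) assms(6) by blast
qed

text \<open>The lowest common ancestor of \<open>c\<close> and \<open>d\<close> is one of them. Were
  it untouched, it would still be above both after an insertion, hence by convexity above the
  touched key \<open>k\<close>; but ancestors of touched keys are touched. A deletion is the same
  with time reversed.\<close>

lemma update_touches_neighbour:
  assumes "(k, Suc s) \<in> upd_points S" and c: "c \<in> alive s \<inter> alive (Suc s)"
    and d: "d \<in> alive s \<inter> alive (Suc s)" and "c < k" "k < d"
    and gap: "\<And>z. z \<in> alive s \<inter> alive (Suc s) \<Longrightarrow> c \<le> z \<Longrightarrow> z \<le> d \<Longrightarrow> z = c \<or> z = d"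
  shows "c \<in> touched s \<or> d \<in> touched s"
proof -
  have s: "s < length S" using assms(1) op_points_Suc_iff unfolding upd_points_iff by blast
  have keys: "set_tree (T s) = alive s" "set_tree (T (Suc s)) = alive (Suc s)"
    using keys_alive s by auto
  have mm: "min c d = c" "max c d = d" using assms(4,5) by auto
  consider "(k, Suc s) \<in> ins_points S" | "(k, Suc s) \<in> del_points S"
    using assms(1) unfolding upd_points_def by blast
  then show ?thesis
  proof cases
    case 1
    note k = run_insert[OF 1]
    have "c \<in> set_tree (T s)" "d \<in> set_tree (T s)" using c d keys by auto
    then obtain z where z: "c \<le> z" "z \<le> d" "ancestor (T s) z c" "ancestor (T s) z d"
      using bst_lca[OF bst_before[OF s], of c d] unfolding mm by blast
    have zT: "z \<in> set_tree (T s)" using ancestor_keys[OF z(3)] by blast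
    then have zcd: "z = c \<or> z = d" using gap z(1,2) k(2) keys by auto
    have "z \<in> touched s"
    proof (rule ccontr)
      assume nz: "z \<notin> touched s"
      then have zc: "ancestor (T (Suc s)) z c" and zd: "ancestor (T (Suc s)) z d"
        using untouched_keeps_ancestor[OF s] z(3,4) by blast+
      have "ancestor (T (Suc s)) z k"
        using bst_ancestor_convex[OF bst_after[OF s] zc zd] assms(4,5) k(2) by simp
      moreover have "k \<in> set_tree (b s)" using touched_after[OF s k(3)] k(2) by simp
      ultimately show False
        using top_subtree_ancestor[OF top_after[OF s] bst_after[OF s]] nz
        unfolding touched_def by blast
    qed
    then show ?thesis using zcd by blast
  next
    case 2
    note k = run_delete[OF 2]
    have "c \<in> set_tree (T (Suc s))" "d \<in> set_tree (T (Suc s))" using c d keys by auto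
    then obtain z where z: "c \<le> z" "z \<le> d" "ancestor (T (Suc s)) z c" "ancestor (T (Suc s)) z d"
      using bst_lca[OF bst_after[OF s], of c d] unfolding mm by blast
    have zT: "z \<in> set_tree (T (Suc s))" using ancestor_keys[OF z(3)] by blast
    then have zcd: "z = c \<or> z = d" using gap z(1,2) k(2) keys by auto
    have "z \<in> touched s"
    proof (rule ccontr)
      assume nz: "z \<notin> touched s"
      then have zc: "ancestor (T s) z c" and zd: "ancestor (T s) z d"
        using reconfiguration_keeps_ancestor_rev[OF reconf[OF s]] z(3,4)
        unfolding touched_def by blast+
      have "ancestor (T s) z k"
        using bst_ancestor_convex[OF bst_before[OF s] zc zd] assms(4,5) k(1) by simp
      moreover have "k \<in> set_tree (a s)" using touched_before[OF s k(3) k(1)] .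
      ultimately show False
        using top_subtree_ancestor[OF top_before[OF s] bst_before[OF s]] nz
        unfolding touched_def by blast
    qed
    then show ?thesis using zcd by blast
  qed
qed

lemma run_satisfied:
  "satisfied n S {(x, Suc s) | x s. s < length S \<and> x \<in> touched s}" (is "satisfied n S ?P")
proof -
  have keys: "set_tree (T s) = alive s" "set_tree (T (Suc s)) = alive (Suc s)" if "s < length S" for s
    using keys_alive that by auto
  have valid: "valid n S p" if pP: "p \<in> ?P" for p
  proof -
    obtain x s where xs: "p = (x, Suc s)" "s < length S" "x \<in> touched s" using pP by blast
    then have "x \<in> alive s \<or> x \<in> alive (Suc s)"
      using a_keys b_keys keys unfolding touched_def by blast
    then show ?thesis using xs valid_Suc_iff by simp
  qed
  have grid: "?P \<subseteq> grid n (length S)" using valid unfolding valid_def by blast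
  have seq: "seq_points S \<subseteq> ?P"
  proof
    fix p assume "p \<in> seq_points S"
    then obtain x t k where p: "p = (x, t)" "(x, t) \<in> op_points k S"
      unfolding seq_points_def upd_points_def by (cases p) auto
    obtain s where s: "t = Suc s" using op_points_time[OF p(2)] by (cases t) auto
    then have "x \<in> touched s" "s < length S"
      using p(2) run_insert(3) run_delete(3) run_access(3) op_points_Suc_iff by (cases k; auto)+
    then show "p \<in> ?P" using p s by blast
  qed
  have pairs: "fst p = fst q \<or> snd p = snd q \<or>
        (\<exists>r \<in> (rect p q \<inter> ?P) - {p, q}.
           (snd r = min (snd p) (snd q) \<longrightarrow> r \<notin> del_points S) \<and>
           (snd r = max (snd p) (snd q) \<longrightarrow> r \<notin> ins_points S))"
    if pq: "p \<in> ?P" "q \<in> ?P" "active_pair n S p q" for p q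
  proof -
    obtain x t where p: "p = (x, Suc t)" "t < length S" "x \<in> touched t" using pq(1) by blast
    obtain y u where q: "q = (y, Suc u)" "u < length S" "y \<in> touched u" using pq(2) by blast
    have le: "t \<le> u" using pq(3) p(1) q(1) unfolding active_pair_def by simp
    show ?thesis
    proof (cases "x = y \<or> t = u")
      case False
      then have tu: "t < u" using le by simp
      then have "\<forall>s\<in>{t<..u}. x \<in> alive s \<and> y \<in> alive s"
        using pq(3) active_pair_iff unfolding p(1) q(1) by blast
      then obtain z s where zs: "min x y \<le> z" "z \<le> max x y" "t \<le> s" "s \<le> u" "z \<in> touched s"
        "(z, s) \<noteq> (x, t)" "(z, s) \<noteq> (y, u)"
        "s = t \<longrightarrow> (z, Suc s) \<notin> del_points S" "s = u \<longrightarrow> (z, Suc s) \<notin> ins_points S"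
        using active_pair_witness[OF tu q(2) _ p(3) q(3)] False by blast
      then have "(z, Suc s) \<in> (rect p q \<inter> ?P) - {p, q}"
        using p q le unfolding rect_def by auto
      moreover have "snd (z, Suc s) = min (snd p) (snd q) \<longrightarrow> (z, Suc s) \<notin> del_points S"
        "snd (z, Suc s) = max (snd p) (snd q) \<longrightarrow> (z, Suc s) \<notin> ins_points S"
        using zs(8,9) tu unfolding p(1) q(1) by auto
      ultimately show ?thesis by blast
    qed (use p q in auto)
  qed
  have neighbours: "c \<in> ?P \<or> d \<in> ?P"
    if upd: "p \<in> upd_points S" and pred: "pred_point n S p = Some c"
      and succ: "succ_point n S p = Some d" for p c d
  proof -
    obtain k t where p: "p = (k, t)" by (cases p)
    have "1 \<le> t \<and> t \<le> length S"
      using upd op_points_time unfolding p upd_points_iff by blast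
    then obtain s where s: "t = Suc s" "s < length S" by (cases t) auto
    obtain c' where c: "c = (c', t)" "c' < k" "valid n S (c', t)"
      "\<And>z. valid n S (z, t) \<Longrightarrow> z < k \<Longrightarrow> z \<le> c'"
      using pred_pointD pred unfolding p by metis
    obtain d' where d: "d = (d', t)" "k < d'" "valid n S (d', t)"
      "\<And>z. valid n S (z, t) \<Longrightarrow> k < z \<Longrightarrow> d' \<le> z"
      using succ_pointD succ unfolding p by metis
    \<comment> \<open>Only one key is updated at a time, so every other key is present on both sides
      of the operation or on neither.\<close>
    have both: "z \<in> alive s \<inter> alive (Suc s)" if "valid n S (z, t)" "z \<noteq> k" for z
      using that upd upd_points_unique[of k t S z] alive_Suc_other[of z s]
      unfolding p s valid_Suc_iff by blast
    have "c' \<in> touched s \<or> d' \<in> touched s"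
    proof (rule update_touches_neighbour)
      show "(k, Suc s) \<in> upd_points S" using upd p s by simp
      show "c' \<in> alive s \<inter> alive (Suc s)" "d' \<in> alive s \<inter> alive (Suc s)"
        using both c d by auto
      show "z = c' \<or> z = d'" if z: "z \<in> alive s \<inter> alive (Suc s)" "c' \<le> z" "z \<le> d'" for z
      proof -
        have "valid n S (z, t)" using z(1) s valid_Suc_iff by simp
        moreover have "z \<noteq> k"
          using z(1) upd alive_insert alive_delete unfolding p s upd_points_def by blast
        ultimately show ?thesis using c(4)[of z] d(4)[of z] z(2,3) by force
      qed
    qed (use c d in auto)
    then show ?thesis using c d s by blast
  qed
  show ?thesis
    unfolding satisfied_def
    by (intro conjI ballI allI impI grid seq valid pairs neighbours) (assumption | elim conjE)+
qed

end

lemma execution_satisfied: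
  assumes "update_sequence n S" "execution n S E"
  shows "satisfied n S (geometric_view E)"
proof -
  define a b where "a s = fst (snd E ! s)" and "b s = snd (snd E ! s)" for s
  obtain T where T: "T 0 = fst E" and E: "bst_on n (fst E)" "length (snd E) = length S"
    and step: "\<And>t. t \<in> {1..length S} \<Longrightarrow>
      reconfiguration n (T (t - 1)) (a (t - 1)) (b (t - 1)) (T t) \<and>
      performs (S ! (t - 1)) (snd E ! (t - 1))"
    using assms(2) unfolding execution_def a_def b_def by blast
  interpret run n S T a b
  proof
    show "reconfiguration n (T s) (a s) (b s) (T (Suc s))" "performs (S ! s) (a s, b s)"
      if "s < length S" for s
      using step[of "Suc s"] that by (auto simp: a_def b_def)
  qed (use assms(1) E T in \<open>auto simp: bst_on_def\<close>)
  have "geometric_view E = {(x, Suc s) | x s. s < length S \<and> x \<in> touched s}"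
  proof -
    have "t \<in> {1..length S} \<and> x \<in> touched (t - 1) \<longleftrightarrow>
      (\<exists>s. t = Suc s \<and> s < length S \<and> x \<in> touched s)" for x t
      by (cases t) auto
    then show ?thesis unfolding geometric_view_def E(2) touched_def a_def b_def by auto
  qed
  then show ?thesis using run_satisfied by simp
qed

section \<open>From satisfied sets to executions\<close>

lemma cone_between:
  assumes "y \<in> cone f A x" "z \<in> A" "min x y \<le> z" "z \<le> max x y"
  shows "z \<in> cone f A x"
proof -
  have "f x \<le> f w" if "w \<in> A" "min x z \<le> w" "w \<le> max x z" for w
  proof -
    have "min x y \<le> w" "w \<le> max x y"
      using that(2,3) assms(3,4) by (auto simp: min_le_iff_disj le_max_iff_disj)
    then show ?thesis using assms(1) that(1) unfolding cone_def by simp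
  qed
  then show ?thesis using assms(2) unfolding cone_def by simp
qed

locale satisfied_set = updates +
  fixes P :: "point set"
  assumes sat: "satisfied n S P"
begin

lemma P_valid: "p \<in> P \<Longrightarrow> valid n S p"
  using sat unfolding satisfied_def by blast

lemma P_time: "(x, t) \<in> P \<Longrightarrow> 1 \<le> t \<and> t \<le> length S"
  using sat unfolding satisfied_def grid_def by auto

lemma op_points_P: "(x, t) \<in> op_points k S \<Longrightarrow> (x, t) \<in> P"
  using sat unfolding satisfied_def seq_points_def upd_points_def by (cases k) auto

lemma upd_points_P: "(x, t) \<in> upd_points S \<Longrightarrow> (x, t) \<in> P"
  using op_points_P unfolding upd_points_iff by blast

lemma active_pair_witness:
  assumes "(a, t) \<in> P" "(c, u) \<in> P" "active_pair n S (a, t) (c, u)" "a \<noteq> c" "t < u"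
  obtains z v where "(z, v) \<in> P" "min a c \<le> z" "z \<le> max a c" "t \<le> v" "v \<le> u"
    "(z, v) \<noteq> (a, t)" "(z, v) \<noteq> (c, u)"
    "v = t \<Longrightarrow> (z, v) \<notin> del_points S" "v = u \<Longrightarrow> (z, v) \<notin> ins_points S"
proof -
  have "\<forall>p \<in> P. \<forall>q \<in> P. active_pair n S p q \<longrightarrow> fst p = fst q \<or> snd p = snd q \<or>
      (\<exists>r \<in> (rect p q \<inter> P) - {p, q}.
        (snd r = min (snd p) (snd q) \<longrightarrow> r \<notin> del_points S) \<and>
        (snd r = max (snd p) (snd q) \<longrightarrow> r \<notin> ins_points S))"
    using sat unfolding satisfied_def by (elim conjE)
  from this[rule_format, OF assms(1-3)] assms(4,5)
  obtain r where r: "r \<in> (rect (a, t) (c, u) \<inter> P) - {(a, t), (c, u)}"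
    "snd r = t \<longrightarrow> r \<notin> del_points S" "snd r = u \<longrightarrow> r \<notin> ins_points S"
    by (auto simp: min_def max_def)
  then show ?thesis
    using that[of "fst r" "snd r"] assms(5) unfolding rect_def by (cases r) simp
qed

text \<open>The nearest valid keys on the two sides of \<open>k\<close> do not lie beyond
  \<open>x\<close> and \<open>y\<close>, and condition (ii) puts one of them into
  \<open>P\<close>.\<close>

lemma update_touches_between:
  assumes "(k, t) \<in> upd_points S" "valid n S (x, t)" "valid n S (y, t)" "x < k" "k < y"
  shows "\<exists>z. z \<noteq> k \<and> x \<le> z \<and> z \<le> y \<and> (z, t) \<in> P"
proof -
  obtain c where c: "pred_point n S (k, t) = Some (c, t)" "x \<le> c" "c < k"
    using pred_point_Some[OF assms(2,4)] by blast
  obtain d where d: "succ_point n S (k, t) = Some (d, t)" "d \<le> y" "k < d"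
    using succ_point_Some[OF assms(3,5)] by blast
  have "(c, t) \<in> P \<or> (d, t) \<in> P"
    using sat assms(1) c(1) d(1) unfolding satisfied_def by blast
  then show ?thesis
  proof
    assume "(c, t) \<in> P"
    then show ?thesis using c(2,3) assms(5) by (intro exI[of _ c]) auto
  next
    assume "(d, t) \<in> P"
    then show ?thesis using d(2,3) assms(4) by (intro exI[of _ d]) auto
  qed
qed

section \<open>Keys in an untouched gap\<close>

lemma alive_persists:
  assumes "x \<in> alive t" "t \<le> v" "\<And>w. t < w \<Longrightarrow> w \<le> v \<Longrightarrow> (x, w) \<notin> P"
  shows "x \<in> alive v"
  using assms(2,3)
proof (induction v rule: dec_induct)
  case (step v)
  then show ?case using alive_Suc_other[of x v] upd_points_P[of x "Suc v"] by auto
qed (use assms(1) in simp)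

lemma inserted_between:
  assumes "x \<notin> alive t" "x \<in> alive v" "t < v"
  shows "\<exists>w. t < w \<and> w \<le> v \<and> (x, w) \<in> ins_points S"
proof (rule ccontr)
  assume none: "\<not> ?thesis"
  have "x \<notin> alive v"
    using less_imp_le[OF assms(3)] none
  proof (induction v rule: dec_induct)
    case (step v)
    then show ?case using alive_Suc_iff[of x v] by auto
  qed (use assms(1) in simp)
  then show False using assms(2) by blast
qed

text \<open>A key that appears inside an untouched gap has to touch a neighbour when it is inserted,
  so the first touch in the gap can only be such an insertion at the very end.\<close>

lemma untouched_gap:
  assumes ends: "\<And>s. t \<le> s \<Longrightarrow> s < u \<Longrightarrow> a \<in> alive s \<and> c \<in> alive s"
    and old: "\<And>z v. z \<in> alive t \<Longrightarrow> a \<le> z \<Longrightarrow> z \<le> c \<Longrightarrow> t < v \<Longrightarrow> v < u \<Longrightarrow> (z, v) \<notin> P"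
    and "z \<notin> alive t" "a \<le> z" "z \<le> c" "t < v" "v \<le> u" "(z, v) \<in> P"
  shows "v = u \<and> (z, u) \<in> ins_points S"
  using assms(3-)
proof (induction v arbitrary: z rule: less_induct)
  case (less v)
  \<comment> \<open>A key absent at \<open>t\<close> and touched at \<open>v\<close> was inserted in
    between. If that happened before \<open>v\<close>, the induction hypothesis would place the
    insertion at \<open>u\<close>, which is too late.\<close>
  have inserted: "(y, v) \<in> ins_points S"
    if y: "(y, v) \<in> P" "y \<notin> alive t" "a \<le> y" "y \<le> c" for y
  proof -
    obtain v' where v': "v = Suc v'" using less.prems(4) by (cases v) auto
    have "y \<in> alive v' \<or> y \<in> alive v" using P_valid[OF y(1)] unfolding v' valid_Suc_iff by blast
    moreover have "v' = t \<or> t < v'" using less.prems(4) v' by auto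
    ultimately obtain w where w: "t < w" "w \<le> v" "(y, w) \<in> ins_points S"
      using inserted_between[OF y(2), of v] inserted_between[OF y(2), of v'] less.prems(4) y(2) v'
      by (metis le_SucI)
    have "w = v"
    proof (rule ccontr)
      assume "w \<noteq> v"
      then have "w < v" using w(2) by simp
      then have "w = u" using less.IH[OF _ y(2-4) w(1) _ op_points_P[OF w(3)]] less.prems(5) by simp
      then show False using \<open>w < v\<close> less.prems(5) by simp
    qed
    then show ?thesis using w(3) by simp
  qed
  have z: "(z, v) \<in> ins_points S" using inserted less.prems by blast
  have "v = u"
  proof (rule ccontr)
    assume "v \<noteq> u"
    then have "v < u" using less.prems(5) by simp
    obtain v' where v': "v = Suc v'" using less.prems(4) by (cases v) auto
    have ac: "a \<in> alive v' \<and> c \<in> alive v'" "a \<in> alive t \<and> c \<in> alive t"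
      using ends[of v'] ends[of t] \<open>v < u\<close> less.prems(4) v' by auto
    have "v < Suc (length S)" using P_time[OF less.prems(6)] by simp
    then have "valid n S (a, v)" "valid n S (c, v)"
      using ac(1) v' valid_Suc_iff by auto
    moreover have "a < z" "z < c" using less.prems(1-3) ac(2) by (auto simp: le_less)
    moreover have "(z, v) \<in> upd_points S" using z unfolding upd_points_def by blast
    ultimately obtain y where y: "y \<noteq> z" "a \<le> y" "y \<le> c" "(y, v) \<in> P"
      using update_touches_between by meson
    \<comment> \<open>A present \<open>y\<close> contradicts \<open>old\<close>; a new one would be
      inserted at \<open>v\<close> like \<open>z\<close>, although each time has only one
      operation.\<close>
    have "y \<notin> alive t" using old[OF _ y(2,3) less.prems(4) \<open>v < u\<close>] y(4) by blast
    then have "(y, v) \<in> ins_points S" using inserted[OF y(4)] y(2,3) by blast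
    then show False using y(1) z op_points_unique by blast
  qed
  then show ?case using z by simp
qed

text \<open>The priority of \<open>x\<close> after time \<open>t\<close>: the time of its next touch, with ties broken in favour
  of the most recently touched key. That tie-break is what keeps an untouched key from being
  moved above a touched one.\<close>

definition next_touch :: "nat \<Rightarrow> nat \<Rightarrow> nat" where
  "next_touch t x = (LEAST u. t < u \<and> ((x, u) \<in> P \<or> u = Suc (length S)))"

primrec last_touch :: "nat \<Rightarrow> nat \<Rightarrow> nat" where
  "last_touch 0 x = 0"
| "last_touch (Suc t) x = (if (x, Suc t) \<in> P then Suc t else last_touch t x)"

text \<open>The order is lexicographic. Subtraction from \<open>length S\<close> makes a recent last
  touch small, and the key itself makes priorities distinct. A key not touched again gets the first
  component \<open>Suc (length S)\<close>, later than every real time.\<close>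

definition prio :: "nat \<Rightarrow> nat \<Rightarrow> nat \<times> nat \<times> nat" where
  "prio t x = (next_touch t x, length S - last_touch t x, x)"

section \<open>Priorities before and after a step\<close>

lemma inj_prio: "inj_on (prio t) A"
  unfolding prio_def inj_on_def by simp

lemma last_touch_le: "last_touch t x \<le> t"
  by (induction t) auto

lemma next_touch_props:
  assumes "t \<le> length S"
  shows "t < next_touch t x" "(x, next_touch t x) \<in> P \<or> next_touch t x = Suc (length S)"
proof -
  have "t < next_touch t x \<and> ((x, next_touch t x) \<in> P \<or> next_touch t x = Suc (length S))"
    unfolding next_touch_def by (rule LeastI[of _ "Suc (length S)"]) (use assms in auto)
  then show "t < next_touch t x" "(x, next_touch t x) \<in> P \<or> next_touch t x = Suc (length S)"
    by auto
qed

lemma next_touch_le: "t < v \<Longrightarrow> (x, v) \<in> P \<Longrightarrow> next_touch t x \<le> v"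
  unfolding next_touch_def by (rule Least_le) simp

lemma next_touch_le_end: "t \<le> length S \<Longrightarrow> next_touch t x \<le> Suc (length S)"
  unfolding next_touch_def by (rule Least_le) simp

lemma next_touch_Suc_iff:
  assumes "t < length S"
  shows "next_touch t x = Suc t \<longleftrightarrow> (x, Suc t) \<in> P"
proof
  show "(x, Suc t) \<in> P" if "next_touch t x = Suc t"
    using next_touch_props(2)[of t x] assms that by simp
  show "next_touch t x = Suc t" if "(x, Suc t) \<in> P"
    using next_touch_le[OF _ that, of t] next_touch_props(1)[of t x] assms by simp
qed

lemma prio_untouched:
  assumes "t < length S" "(x, Suc t) \<notin> P"
  shows "prio (Suc t) x = prio t x"
proof -
  have "Suc t < u \<and> ((x, u) \<in> P \<or> u = Suc (length S)) \<longleftrightarrow>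
    t < u \<and> ((x, u) \<in> P \<or> u = Suc (length S))" for u
    using assms by (cases "u = Suc t") auto
  then show ?thesis using assms(2) unfolding prio_def next_touch_def by simp
qed

text \<open>\<open>Suc t\<close> is the smallest possible next touch after \<open>t\<close>, so no
  untouched key can precede a touched one in the old order.\<close>

lemma prio_le_touched:
  assumes "t < length S" "prio t x \<le> prio t y" "(y, Suc t) \<in> P"
  shows "(x, Suc t) \<in> P"
proof -
  have "next_touch t x \<le> Suc t"
    using assms next_touch_Suc_iff[OF assms(1), of y] unfolding prio_def by auto
  then have "next_touch t x = Suc t" using next_touch_props(1)[of t x] assms(1) by simp
  then show ?thesis using next_touch_Suc_iff[OF assms(1)] by blast
qed

text \<open>The tie-break acts here: a key touched at \<open>Suc t\<close> wins every tie against an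
  untouched one, so the latter can precede it only by a strictly earlier next touch.\<close>

lemma prio_le_next_touch:
  assumes "t < length S" "prio (Suc t) x \<le> prio (Suc t) y" "(x, Suc t) \<notin> P"
  shows "next_touch (Suc t) x \<le> next_touch (Suc t) y"
    and "(y, Suc t) \<in> P \<Longrightarrow> next_touch (Suc t) x < next_touch (Suc t) y"
proof -
  show le: "next_touch (Suc t) x \<le> next_touch (Suc t) y" using assms(2) unfolding prio_def by auto
  show "next_touch (Suc t) x < next_touch (Suc t) y" if "(y, Suc t) \<in> P"
  proof -
    have "length S - last_touch (Suc t) y < length S - last_touch (Suc t) x"
      using that assms(1,3) last_touch_le[of t x] by simp
    then have "next_touch (Suc t) x \<noteq> next_touch (Suc t) y"
      using assms(2) unfolding prio_def by auto
    then show ?thesis using le by simp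
  qed
qed

text \<open>Induction on the distance of the keys. The pair \<open>(b, Suc t)\<close>,
  \<open>(x, u)\<close> needs a witness. A present key touched at \<open>Suc t\<close> replaces
  \<open>b\<close>, one touched at \<open>u\<close> replaces \<open>x\<close>, and the new pair is
  closer. The strict inequality for touched keys ensures that a replacement for \<open>x\<close> is
  untouched at \<open>Suc t\<close>.\<close>

lemma no_bad_pair:
  assumes t: "t < length S" and u: "u \<le> length S"
    and "b \<in> alive (Suc t)" "(b, Suc t) \<in> P" "x \<in> alive (Suc t)" "(x, Suc t) \<notin> P"
    and "next_touch (Suc t) x = u"
    and "\<And>z. \<lbrakk>z \<in> alive (Suc t); min b x \<le> z; z \<le> max b x\<rbrakk> \<Longrightarrow>
      u \<le> next_touch (Suc t) z \<and> ((z, Suc t) \<in> P \<longrightarrow> u < next_touch (Suc t) z)"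
  shows False
  using assms(3-)
proof (induction "max b x - min b x" arbitrary: b x rule: less_induct)
  case less
  let ?s = "Suc t"
  have s: "?s \<le> length S" using t by simp
  have su: "?s < u" "(x, u) \<in> P" using next_touch_props[OF s, of x] less.prems(5) u by auto
  then obtain u' where u': "u = Suc u'" "t < u'" by (cases u) auto
  have untouched: "(z, v) \<notin> P"
    if "z \<in> alive ?s" "min b x \<le> z" "z \<le> max b x" "?s < v" "v < u" for z v
    using next_touch_le[of ?s v z] less.prems(6)[OF that(1-3)] that(4,5) by auto
  have stays: "z \<in> alive v"
    if "z \<in> alive ?s" "min b x \<le> z" "z \<le> max b x" "?s \<le> v" "v < u" for z v
    by (rule alive_persists[OF that(1,4)]) (use untouched[OF that(1-3)] that(5) in auto)
  have "active_pair n S (b, Suc t) (x, Suc u')"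
    unfolding active_pair_iff[OF u'(2)]
    using stays less.prems(1,3) u u' by auto
  moreover have "b \<noteq> x" using less.prems(2,4) by blast
  ultimately obtain z v where r: "(z, v) \<in> P" and z: "min b x \<le> z" "z \<le> max b x"
    and v: "?s \<le> v" "v \<le> u" and neq: "(z, v) \<noteq> (b, ?s)" "(z, v) \<noteq> (x, u)"
    and no: "v = ?s \<Longrightarrow> (z, v) \<notin> del_points S" "v = u \<Longrightarrow> (z, v) \<notin> ins_points S"
    using active_pair_witness[OF less.prems(2) su(2)] su(1) u'(1) by metis
  have sub: "min b x \<le> min z' z''" "max z' z'' \<le> max b x"
    if "z' \<in> {b, x, z}" "z'' \<in> {b, x, z}" for z' z''
    using that z by auto
  show False
  proof (cases "z \<in> alive ?s")
    case True
    note zt = less.prems(6)[OF True z]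
    show False
    proof (cases "v = ?s")
      case v: True
      have "z \<noteq> b" "(z, ?s) \<in> P" using r neq(1) v by auto
      moreover from this have "z \<noteq> x" using less.prems(4) by blast
      ultimately have "max z x - min z x < max b x - min b x"
        using z by (auto simp: min_def max_def split: if_splits)
      then show False
        by (rule less.hyps[OF _ True \<open>(z, ?s) \<in> P\<close> less.prems(3-5)])
          (use less.prems(6) sub[of z x] in force)
    next
      case False
      then have "v = u" using untouched[OF True z, of v] r v by force
      then have zu: "next_touch ?s z = u" "z \<noteq> x"
        using next_touch_le[of ?s u z] su(1) r neq(2) zt by auto
      then have nz: "(z, ?s) \<notin> P" using zt by auto
      then have "z \<noteq> b" using less.prems(2) by blast
      then have "max b z - min b z < max b x - min b x"
        using z zu(2) by (auto simp: min_def max_def split: if_splits)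
      then show False
        by (rule less.hyps[OF _ less.prems(1,2) True nz zu(1)])
          (use less.prems(6) sub[of b z] in force)
    qed
  next
    case False
    show False
    proof (cases "v = ?s")
      case v: True
      then have "z \<in> alive t" using P_valid[OF r] False valid_Suc_iff by blast
      then have "(z, ?s) \<in> del_points S" using False alive_Suc_iff by blast
      then show False using no(1) v by simp
    next
      case v': False
      \<comment> \<open>A key absent after the first time can be touched in the rectangle only by
        its own insertion at \<open>u\<close>, which is not an admissible witness.\<close>
      have "v = u \<and> (z, u) \<in> ins_points S"
      proof (rule untouched_gap[of ?s u "min b x" "max b x"])
        show "min b x \<in> alive s \<and> max b x \<in> alive s" if "?s \<le> s" "s < u" for s
          using stays[of b s] stays[of x s] less.prems(1,3) that by (auto simp: min_def max_def)
      qed (use untouched False z v v' r in auto)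
      then show False using no(2) by simp
    qed
  qed
qed

lemma touched_up_closed:
  assumes t: "t < length S" and b: "b \<in> alive (Suc t)" "(b, Suc t) \<in> P"
    and x: "x \<in> alive (Suc t)" "b \<in> cone (prio (Suc t)) (alive (Suc t)) x"
  shows "(x, Suc t) \<in> P"
proof (rule ccontr)
  assume nx: "(x, Suc t) \<notin> P"
  let ?u = "next_touch (Suc t) x"
  have le: "prio (Suc t) x \<le> prio (Suc t) z"
    if "z \<in> alive (Suc t)" "min b x \<le> z" "z \<le> max b x" for z
    using x(2) that unfolding cone_def by (simp add: min.commute max.commute)
  have "?u < next_touch (Suc t) b"
    using prio_le_next_touch(2)[OF t le[OF b(1)] nx b(2)] by simp
  \<comment> \<open>Being strictly earlier than another next touch, \<open>?u\<close> is a real time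
    and not the default value \<open>Suc (length S)\<close>.\<close>
  then have "?u \<le> length S" using next_touch_le_end[of "Suc t" b] t by simp
  then show False
    using no_bad_pair[OF t _ b x(1) nx refl] prio_le_next_touch[OF t le nx] by blast
qed

text \<open>If the presence of \<open>z\<close> changed, \<open>z\<close> would be the updated key,
  strictly inside the segment. Condition (ii) yields another touched key there, which is not updated
  and so belongs to \<open>A\<close> for either choice of \<open>A\<close>. The two choices serve
  the two inclusions between cones.\<close>

lemma untouched_segment:
  assumes t: "t < length S" and A: "A = alive t \<or> A = alive (Suc t)"
    and xy: "x \<in> A" "y \<in> A"
    and none: "\<And>z. z \<in> A \<Longrightarrow> min x y \<le> z \<Longrightarrow> z \<le> max x y \<Longrightarrow> (z, Suc t) \<notin> P"
    and z: "min x y \<le> z" "z \<le> max x y"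
  shows "z \<in> alive t \<longleftrightarrow> z \<in> alive (Suc t)"
proof (rule ccontr)
  assume differ: "(z \<in> alive t) \<noteq> (z \<in> alive (Suc t))"
  then have upd: "(z, Suc t) \<in> upd_points S" using alive_Suc_other by blast
  then have zP: "(z, Suc t) \<in> P" by (rule upd_points_P)
  then have "z \<notin> A" using none z by blast
  then have "min x y < z" "z < max x y" using xy z by (auto simp: min_def max_def le_less)
  moreover have "valid n S (min x y, Suc t)" "valid n S (max x y, Suc t)"
    using xy A t unfolding valid_Suc_iff min_def max_def by auto
  ultimately obtain w where w: "w \<noteq> z" "min x y \<le> w" "w \<le> max x y" "(w, Suc t) \<in> P"
    using update_touches_between[OF upd] by meson
  then have "(w, Suc t) \<notin> upd_points S" using upd upd_points_unique by blast
  then have "w \<in> A" using P_valid[OF w(4)] A alive_Suc_other unfolding valid_Suc_iff by blast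
  then show False using none w by blast
qed

text \<open>The cone of an untouched key contains no touched key: in the old order because touched
  keys come first, in the new one by \<open>touched_up_closed\<close>. On such a segment the
  operation changes neither presence nor priorities.\<close>

lemma untouched_cone:
  assumes t: "t < length S" and x: "x \<in> alive t" "(x, Suc t) \<notin> P"
  shows "x \<in> alive (Suc t)"
    and "cone (prio t) (alive t) x = cone (prio (Suc t)) (alive (Suc t)) x"
    and "y \<in> cone (prio t) (alive t) x \<Longrightarrow> prio t y = prio (Suc t) y"
proof -
  show x': "x \<in> alive (Suc t)" using x upd_points_P alive_Suc_other by blast
  have untouched: "(y, Suc t) \<notin> P" if "y \<in> cone (prio t) (alive t) x" for y
  proof -
    have "prio t x \<le> prio t y" using that unfolding cone_def by simp
    then show ?thesis using prio_le_touched[OF t] x(2) by blast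
  qed
  have untouched': "(y, Suc t) \<notin> P" if "y \<in> cone (prio (Suc t)) (alive (Suc t)) x" for y
    using touched_up_closed[OF t _ _ x' that] x(2) that unfolding cone_def by blast
  show "prio t y = prio (Suc t) y" if "y \<in> cone (prio t) (alive t) x"
    using prio_untouched[OF t untouched[OF that]] by simp
  show "cone (prio t) (alive t) x = cone (prio (Suc t)) (alive (Suc t)) x"
  proof (intro set_eqI iffI)
    fix y assume y: "y \<in> cone (prio t) (alive t) x"
    then have yA: "y \<in> alive t" unfolding cone_def by simp
    have none: "(z, Suc t) \<notin> P" if "z \<in> alive t" "min x y \<le> z" "z \<le> max x y" for z
      using untouched[OF cone_between[OF y that]] .
    have same: "z \<in> alive t \<longleftrightarrow> z \<in> alive (Suc t)" if "min x y \<le> z" "z \<le> max x y" for z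
      using untouched_segment[OF t _ x(1) yA none that] by simp
    have "prio (Suc t) x \<le> prio (Suc t) z"
      if z: "z \<in> alive (Suc t)" "min x y \<le> z" "z \<le> max x y" for z
    proof -
      have "z \<in> alive t" using same z by blast
      then have "prio t x \<le> prio t z" using y z(2,3) unfolding cone_def by simp
      then show ?thesis
        using prio_untouched[OF t] none[OF \<open>z \<in> alive t\<close> z(2,3)] x(2) by simp
    qed
    moreover have "y \<in> alive (Suc t)" using same[of y] yA by simp
    ultimately show "y \<in> cone (prio (Suc t)) (alive (Suc t)) x" unfolding cone_def by simp
  next
    fix y assume y: "y \<in> cone (prio (Suc t)) (alive (Suc t)) x"
    then have yA: "y \<in> alive (Suc t)" unfolding cone_def by simp
    have none: "(z, Suc t) \<notin> P" if "z \<in> alive (Suc t)" "min x y \<le> z" "z \<le> max x y" for z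
      using untouched'[OF cone_between[OF y that]] .
    have same: "z \<in> alive t \<longleftrightarrow> z \<in> alive (Suc t)" if "min x y \<le> z" "z \<le> max x y" for z
      using untouched_segment[OF t _ x' yA none that] by simp
    have "prio t x \<le> prio t z"
      if z: "z \<in> alive t" "min x y \<le> z" "z \<le> max x y" for z
    proof -
      have "z \<in> alive (Suc t)" using same z by blast
      then have "prio (Suc t) x \<le> prio (Suc t) z" using y z(2,3) unfolding cone_def by simp
      then show ?thesis
        using prio_untouched[OF t] none[OF \<open>z \<in> alive (Suc t)\<close> z(2,3)] x(2) by simp
    qed
    moreover have "y \<in> alive t" using same[of y] yA by simp
    ultimately show "y \<in> cone (prio t) (alive t) x" unfolding cone_def by simp
  qed
qed

section \<open>The execution made of treaps\<close>

definition tree :: "nat \<Rightarrow> nat tree" where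
  "tree t = treap (prio t) (alive t)"

definition top_old :: "nat \<Rightarrow> nat tree" where
  "top_old t = treap (prio t) {x \<in> alive t. (x, Suc t) \<in> P}"

definition top_new :: "nat \<Rightarrow> nat tree" where
  "top_new t = treap (prio (Suc t)) {x \<in> alive (Suc t). (x, Suc t) \<in> P}"

lemma set_trees:
  "set_tree (tree t) = alive t"
  "set_tree (top_old t) = {x \<in> alive t. (x, Suc t) \<in> P}"
  "set_tree (top_new t) = {x \<in> alive (Suc t). (x, Suc t) \<in> P}"
  unfolding tree_def top_old_def top_new_def by auto

lemma bst_on_treap: "A \<subseteq> alive t \<Longrightarrow> bst_on n (treap f A)"
  using finite_subset[OF _ finite_alive] alive_key
  unfolding bst_on_def by (metis bst_treap set_treap subsetD subsetI)

lemma performs_tops: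
  assumes "t < length S"
  shows "performs (S ! t) (top_old t, top_new t)"
proof -
  obtain s k where sk: "S ! t = (s, k)" by (cases "S ! t")
  then have op: "(s, Suc t) \<in> op_points k S" using assms unfolding op_points_def by simp
  note P = op_points_P[OF op]
  have others: "x \<in> alive (Suc t) \<longleftrightarrow> x \<in> alive t" if "x \<noteq> s \<or> k = Access" for x
    by (rule alive_Suc_other) (use op_points_unique[OF op] that in \<open>auto simp: upd_points_iff\<close>)
  show ?thesis
  proof (cases k)
    case Access
    then have "alive (Suc t) = alive t" using others by blast
    moreover have "s \<in> alive t" using P_valid[OF P] calculation valid_Suc_iff by blast
    ultimately show ?thesis using P Access unfolding sk performs_def by (simp add: set_trees)
  next
    case Insert
    then have s: "s \<notin> alive t" "s \<in> alive (Suc t)" using alive_insert op by auto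
    then have "x \<in> alive (Suc t) \<longleftrightarrow> x \<in> insert s (alive t)" for x
      using others[of x] by (cases "x = s") auto
    then have "alive (Suc t) = insert s (alive t)" by blast
    with s(1) show ?thesis using P Insert unfolding sk performs_def by (auto simp: set_trees)
  next
    case Delete
    then have s: "s \<in> alive t" "s \<notin> alive (Suc t)" using alive_delete op by auto
    then have "x \<in> alive t \<longleftrightarrow> x \<in> insert s (alive (Suc t))" for x
      using others[of x] by (cases "x = s") auto
    then have "alive t = insert s (alive (Suc t))" by blast
    with s(2) show ?thesis using P Delete unfolding sk performs_def by (auto simp: set_trees)
  qed
qed

lemma tops_key_sets:
  assumes "t < length S"
  shows "set_tree (top_new t) = set_tree (top_old t) \<or>
    (\<exists>k. k \<notin> set_tree (tree t) \<and> set_tree (top_new t) = insert k (set_tree (top_old t))) \<or>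
    (\<exists>k \<in> set_tree (top_old t). set_tree (top_new t) = set_tree (top_old t) - {k})"
proof -
  obtain s k where sk: "S ! t = (s, k)" by (cases "S ! t")
  then have op: "(s, Suc t) \<in> op_points k S" using assms unfolding op_points_def by simp
  note perf = performs_tops[OF assms, unfolded sk performs_def]
  show ?thesis
  proof (cases k)
    case Access
    then show ?thesis using perf by simp
  next
    case Insert
    then have "s \<notin> set_tree (tree t)" using alive_insert[of s t] op by (simp add: set_trees)
    then show ?thesis using perf Insert by auto
  next
    case Delete
    then show ?thesis using perf by auto
  qed
qed

lemma reconfiguration_tops:
  assumes t: "t < length S"
  shows "reconfiguration n (tree t) (top_old t) (top_new t) (tree (Suc t))"
proof -
  have "bst_on n (tree t)" "bst_on n (tree (Suc t))" "bst_on n (top_new t)"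
    unfolding tree_def top_new_def by (rule bst_on_treap; blast)+
  moreover have "top_subtree (top_old t) (tree t)"
    unfolding top_old_def tree_def
  proof (rule treap_top_subtree[OF finite_alive inj_prio])
    fix b x assume *: "b \<in> {x \<in> alive t. (x, Suc t) \<in> P}" "x \<in> alive t"
      "b \<in> cone (prio t) (alive t) x"
    then have "prio t x \<le> prio t b" unfolding cone_def by simp
    then show "x \<in> {x \<in> alive t. (x, Suc t) \<in> P}" using prio_le_touched[OF t] * by blast
  qed blast
  moreover have "top_subtree (top_new t) (tree (Suc t))"
    unfolding top_new_def tree_def
    by (rule treap_top_subtree[OF finite_alive inj_prio]) (use touched_up_closed[OF t] in auto)
  moreover have "set_tree (tree (Suc t)) =
    (set_tree (tree t) - set_tree (top_old t)) \<union> set_tree (top_new t)"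
  proof -
    have "x \<in> alive (Suc t) \<longleftrightarrow> x \<in> alive t" if "(x, Suc t) \<notin> P" for x
      using that alive_Suc_other upd_points_P by blast
    then show ?thesis unfolding set_trees by auto
  qed
  moreover have "(x, cl, cr) \<in> children (tree (Suc t))"
    if ch: "(x, cl, cr) \<in> children (tree t)" and "x \<notin> set_tree (top_old t)" for x cl cr
  proof -
    have "x \<in> set_tree (tree t)" using ch node_key unfolding children_def by auto
    then have x: "x \<in> alive t" "(x, Suc t) \<notin> P" using that(2) by (auto simp: set_trees)
    \<comment> \<open>The subtree of an untouched key is the treap on its cone, and neither the cone
      nor the priorities on it have changed.\<close>
    show ?thesis
      using treap_children_eq[OF finite_alive inj_prio finite_alive inj_prio
          untouched_cone[OF t x] ch[unfolded tree_def]]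
      unfolding tree_def by blast
  qed
  ultimately show ?thesis using tops_key_sets[OF t] unfolding reconfiguration_def by blast
qed

lemma satisfied_execution: "\<exists>E. execution n S E \<and> P = geometric_view E"
proof -
  define E where "E = (tree 0, map (\<lambda>t. (top_old t, top_new t)) [0..<length S])"
  have E: "fst E = tree 0" "length (snd E) = length S"
    "\<And>t. t < length S \<Longrightarrow> snd E ! t = (top_old t, top_new t)"
    unfolding E_def by auto
  have bst: "bst_on n (tree 0)" unfolding tree_def by (rule bst_on_treap) blast
  have step: "reconfiguration n (tree (t - 1)) (fst (snd E ! (t - 1))) (snd (snd E ! (t - 1))) (tree t) \<and>
      performs (S ! (t - 1)) (snd E ! (t - 1))" if t: "t \<in> {1..length S}" for t
  proof -
    obtain s where s: "t = Suc s" "s < length S" using t by (cases t) auto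
    then show ?thesis using E(3)[of s] reconfiguration_tops[of s] performs_tops[of s] by simp
  qed
  have "execution n S E"
    unfolding execution_def E(1,2) by (intro conjI exI[of _ tree] ballI bst refl) (use step in blast)+
  have "(x, t) \<in> P \<longleftrightarrow> (x, t) \<in> geometric_view E" for x t
  proof (cases "t \<in> {1..length S}")
    case True
    then obtain s where s: "t = Suc s" "s < length S" by (cases t) auto
    then have "(x, t) \<in> geometric_view E \<longleftrightarrow> (x \<in> alive s \<or> x \<in> alive (Suc s)) \<and> (x, Suc s) \<in> P"
      using E(2) E(3)[of s] unfolding geometric_view_def by (auto simp: set_trees)
    \<comment> \<open>Every point of \<open>P\<close> is valid, so its key is present before or
      after the operation and no point is lost.\<close>
    then show ?thesis using P_valid[of "(x, Suc s)"] s valid_Suc_iff by blast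
  next
    case False
    then show ?thesis using P_time[of x t] E(2) unfolding geometric_view_def by auto
  qed
  then have "P = geometric_view E" by (simp add: set_eq_iff)
  with \<open>execution n S E\<close> show ?thesis by blast
qed

end

theorem theorem13:
  fixes n m :: nat and S :: update_seq and P :: "point set"
  assumes "update_sequence n S" and "length S = m"
    and "P \<subseteq> grid n m"
  shows "satisfied n S P \<longleftrightarrow> (\<exists>E. execution n S E \<and> P = geometric_view E)"
proof
  assume "satisfied n S P"
  with assms(1) interpret satisfied_set n S P by unfold_locales
  show "\<exists>E. execution n S E \<and> P = geometric_view E" by (rule satisfied_execution)
next
  assume "\<exists>E. execution n S E \<and> P = geometric_view E"
  then show "satisfied n S P" using execution_satisfied[OF assms(1)] by blast
qed

end
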